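(* Let $I$ be a nonempty denumerable index set, let $\{X_i, i\in I\}$ and $\{Y_i, i\in I\}$ be two mean-zero Gaussian processes such that $$E(X_i-X_j)^2 \le E(Y_i-Y_j)^2 \quad\text{for all } i,j\in I,$$ let $\{m_i, i\in I\}$ be arbitrary real constants, and let $k\in I$. Let $g:\mathbb{R}\to\mathbb{R}$ be non-decreasing and convex, and suppose that at least one of the following holds: (i) $g(-\infty)>-\infty$; (ii) $\max\Big[E g_+\big(\sup_{i\in I}\{X_i+m_i\}-X_k\big),\; E g_+\big(\sup_{i\in I}\{Y_i+m_i\}-Y_k\big)\Big]<\infty$. Then $$E g\Big(\sup_{i\in I}\{X_i+m_i\}-X_k\Big) \le E g\Big(\sup_{i\in I}\{Y_i+m_i\}-Y_k\Big).$$
   Context: "Denumerable" means countable (finite or countably infinite). A mean-zero Gaussian process indexed by $I$ is a family of real random variables such that every finite linear combination is a (possibly degenerate) centered Gaussian variable. Notation: $g_+=\max\{g,0\}$, $g(-\infty)=\lim_{t\to-\infty}g(t)$, and $g(+\infty)=\lim_{t\to+\infty}g(t)$. Suprema may take the value $+\infty$, and expectations are taken in the extended sense. *)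

theory Defs
  imports "HOL-Probability.Probability"
begin

definition centered_gaussian :: "'a measure \<Rightarrow> ('a \<Rightarrow> real) \<Rightarrow> bool" where
  "centered_gaussian M Z \<longleftrightarrow>
     Z \<in> borel_measurable M \<and>
     (distr M borel Z = return borel 0 \<or>
      (\<exists>\<sigma>>0. distributed M lborel Z (\<lambda>x. ennreal (normal_density 0 \<sigma> x))))"

definition mean_zero_gaussian_process ::
  "'a measure \<Rightarrow> 'i set \<Rightarrow> ('i \<Rightarrow> 'a \<Rightarrow> real) \<Rightarrow> bool" where
  "mean_zero_gaussian_process M I X \<longleftrightarrow>
     (\<forall>J c. finite J \<longrightarrow> J \<subseteq> I \<longrightarrow>
        centered_gaussian M (\<lambda>\<omega>. \<Sum>j\<in>J. c j * X j \<omega>))"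

(* The limits exist in the extended reals for monotone g; for other g the values at
   infinity may be unspecified. *)
definition extend_by_limits :: "(real \<Rightarrow> real) \<Rightarrow> ereal \<Rightarrow> ereal" where
  "extend_by_limits g x =
     (case x of
        ereal t \<Rightarrow> ereal (g t)
      | PInfty \<Rightarrow> Lim at_top (\<lambda>t. ereal (g t))
      | MInfty \<Rightarrow> Lim at_bot (\<lambda>t. ereal (g t)))"

definition pos_part :: "(real \<Rightarrow> real) \<Rightarrow> real \<Rightarrow> real" where
  "pos_part g t = max (g t) 0"

(* Extended expectation of the positive part minus that of the negative part. It is
   meaningful when one of the two is finite; if both are infinite, the ereal convention
   \<infinity> - \<infinity> = \<infinity> applies. For g monotone and Z = sup (X_i + m_i) - X_k the negative part
   of g(Z) is always bounded, because Z \<ge> m_k everywhere. *)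
definition ext_expectation :: "'a measure \<Rightarrow> ('a \<Rightarrow> ereal) \<Rightarrow> ereal" where
  "ext_expectation M Z =
     enn2ereal (\<integral>\<^sup>+\<omega>. e2ennreal (max (Z \<omega>) 0) \<partial>M)
     - enn2ereal (\<integral>\<^sup>+\<omega>. e2ennreal (max (- Z \<omega>) 0) \<partial>M)"

definition shifted_sup ::
  "'i set \<Rightarrow> ('i \<Rightarrow> real) \<Rightarrow> ('i \<Rightarrow> 'a \<Rightarrow> real) \<Rightarrow> 'i \<Rightarrow> 'a \<Rightarrow> ereal" where
  "shifted_sup I m X k \<omega> = (SUP i\<in>I. ereal (X i \<omega> + m i)) - ereal (X k \<omega>)"

end

theory Submission
  imports Defs
begin

text \<open>
  Since \<open>Z = sup (X i + m i) - X k\<close> is bounded below by \<open>m k\<close>, monotone convergence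
  reduces the claim to finite index sets. There, the maximum of \<open>Z\<close> and a constant \<open>t\<close> is again of
  the same form (raise \<open>m k\<close> to at least \<open>t\<close>), and a nondecreasing convex function is a limit of
  nonnegative combinations of hinges, so it suffices to compare expected maxima of \<open>X i + m i\<close>.
  The maximum is a limit of rescaled functions \<open>ln (\<Sum> exp x\<^sub>i)\<close>, whose second-order Taylor term is
  \<open>1/4 \<Sum> p\<^sub>i p\<^sub>j (v\<^sub>i - v\<^sub>j)\<^sup>2\<close>: it depends on the increments only. By Gaussianity,
  \<open>\<alpha> X + \<beta> Y\<close> has the law of \<open>\<alpha>' X + \<beta> Y + \<gamma> X'\<close> with an independent copy \<open>X'\<close> and
  \<open>\<alpha>\<^sup>2 = \<alpha>'\<^sup>2 + \<gamma>\<^sup>2\<close>; replacing \<open>\<gamma> X'\<close> by \<open>\<gamma> Y'\<close> with \<open>\<gamma>\<^sup>2 = 1/n\<close>, Lindeberg's argument moves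
  from \<open>X\<close> to \<open>Y\<close> in \<open>n\<close> steps, each with an error of order \<open>\<gamma>\<^sup>3\<close>.
\<close>

section \<open>Moments of centered Gaussian variables\<close>

text \<open>Adding a constant to all coordinates adds it to the softmax, so the Hessian of the
  softmax annihilates constant vectors. This is why a hypothesis on increments alone can control its
  second-order term. The subtracted \<open>X k\<close> has mean zero, so it drops out of expected
  maxima; it is also what turns truncation at \<open>t\<close> into a change of the single constant
  \<open>m k\<close>. The obstacle is that \<open>X\<close> and \<open>Y\<close> live on different
  spaces and are known only through their linear combinations. Product measures supply the
  independent copies, and equality of joint laws is recovered from characteristic functions of
  linear combinations. No joint density and no derivative along the path from \<open>X\<close> to
  \<open>Y\<close> is used, so degenerate covariances are treated like all others. Squares of
  coefficients add under independence; hence n steps with \<gamma> squared equal to 1/n, whose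
  errors sum to a multiple of n times \<gamma> cubed, that is, of 1/sqrt n.\<close>

lemma centered_gaussian_distr:
  assumes "prob_space M" "centered_gaussian M Z"
  obtains \<sigma> where "distr M borel Z = distr std_normal_distribution borel (\<lambda>x. \<sigma> * x)"
proof -
  interpret N: real_distribution std_normal_distribution by (rule real_dist_normal_dist)
  from assms(2) consider "distr M borel Z = return borel 0"
    | \<sigma> where "\<sigma> > 0" "distributed M lborel Z (\<lambda>x. ennreal (normal_density 0 \<sigma> x))"
    by (auto simp: centered_gaussian_def)
  then show ?thesis
  proof cases
    case 1
    \<comment> \<open>The scale 0 makes the point mass a scaled standard normal too, so both cases
      of \<open>centered_gaussian\<close> share one form.\<close>
    have "distr std_normal_distribution borel (\<lambda>x. 0 * x) = return borel 0"
      by (simp add: N.distr_const)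
    with 1 that[of 0] show ?thesis by simp
  next
    case 2
    have "distributed std_normal_distribution lborel (\<lambda>x. x) (\<lambda>x. ennreal (std_normal_density x))"
      by (simp add: distributed_def distr_id2)
    from N.normal_density_affine[OF this, of \<sigma> 0] 2(1)
    have "distributed std_normal_distribution lborel (\<lambda>x. \<sigma> * x) (\<lambda>x. ennreal (normal_density 0 \<sigma> x))"
      by simp
    then have "distr std_normal_distribution lborel (\<lambda>x. \<sigma> * x) = density lborel (\<lambda>x. ennreal (normal_density 0 \<sigma> x))"
      by (simp add: distributed_def)
    also have "\<dots> = distr M lborel Z"
      using 2(2) by (simp add: distributed_def)
    finally have "distr std_normal_distribution borel (\<lambda>x. \<sigma> * x) = distr M borel Z"
      by (simp cong: distr_cong)
    with that[of \<sigma>] show ?thesis by simp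
  qed
qed

text \<open>Everything is pulled back to the standard normal along the scaling by \<sigma>. The
  characteristic function is expressed through the second moment instead of \<sigma>, so that it
  applies directly to linear combinations, whose \<sigma> has no formula.\<close>

lemma centered_gaussian_moments:
  assumes M: "prob_space M" and Z: "centered_gaussian M Z"
  shows "integrable M Z" "integrable M (\<lambda>x. (Z x)\<^sup>2)" "integrable M (\<lambda>x. \<bar>Z x\<bar>^3)"
    "(\<integral>x. Z x \<partial>M) = 0"
    "(\<integral>x. iexp (Z x) \<partial>M) = complex_of_real (exp (- (\<integral>x. (Z x)\<^sup>2 \<partial>M) / 2))"
proof -
  have [measurable]: "Z \<in> borel_measurable M"
    using Z by (simp add: centered_gaussian_def)
  obtain \<sigma> where D: "distr M borel Z = distr std_normal_distribution borel (\<lambda>x. \<sigma> * x)"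
    using centered_gaussian_distr[OF M Z] .
  \<comment> \<open>The value type is left general because the transfer serves real powers as well
    as the complex \<open>iexp\<close>.\<close>
  have int: "integrable M (\<lambda>x. f (Z x)) \<longleftrightarrow> integrable std_normal_distribution (\<lambda>x. f (\<sigma> * x))"
    "(\<integral>x. f (Z x) \<partial>M) = (\<integral>x. f (\<sigma> * x) \<partial>std_normal_distribution)"
    if [measurable]: "f \<in> borel_measurable borel" for f :: "real \<Rightarrow> 'c::{banach, second_countable_topology}"
  proof -
    show "integrable M (\<lambda>x. f (Z x)) \<longleftrightarrow> integrable std_normal_distribution (\<lambda>x. f (\<sigma> * x))"
      using integrable_distr_eq[of Z M borel f] integrable_distr_eq[of "\<lambda>x. \<sigma> * x" std_normal_distribution borel f] D
      by simp
    show "(\<integral>x. f (Z x) \<partial>M) = (\<integral>x. f (\<sigma> * x) \<partial>std_normal_distribution)"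
      using integral_distr[of Z M borel f] integral_distr[of "\<lambda>x. \<sigma> * x" std_normal_distribution borel f] D
      by simp
  qed
  note mom = integrable_std_normal_distribution_moment
  have m1: "integrable std_normal_distribution (\<lambda>x::real. x)"
    using mom[of 1] by simp
  have m0: "(\<integral>x. x \<partial>std_normal_distribution) = (0::real)"
    using integral_std_normal_distribution_moment_odd[of 1] by simp
  have m2: "(\<integral>x. x\<^sup>2 \<partial>std_normal_distribution) = (1::real)"
    using std_normal_distribution_even_moments[of 1] by simp
  have meas: "(\<lambda>x::real. x) \<in> borel_measurable borel" "(\<lambda>x::real. x\<^sup>2) \<in> borel_measurable borel"
    "(\<lambda>x::real. \<bar>x\<bar>^3) \<in> borel_measurable borel" "iexp \<in> borel_measurable borel"
    by measurable
  show "integrable M Z"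
    unfolding int(1)[OF meas(1)] by (intro integrable_mult_right m1)
  show "integrable M (\<lambda>x. (Z x)\<^sup>2)"
    unfolding int(1)[OF meas(2)] power_mult_distrib by (intro integrable_mult_right mom)
  show "integrable M (\<lambda>x. \<bar>Z x\<bar>^3)"
    unfolding int(1)[OF meas(3)] unfolding power_abs[symmetric] power_mult_distrib
    by (intro integrable_abs integrable_mult_right mom)
  show "(\<integral>x. Z x \<partial>M) = 0"
    unfolding int(2)[OF meas(1)] integral_mult_right_zero m0 by simp
  have "(\<integral>x. (Z x)\<^sup>2 \<partial>M) = \<sigma>\<^sup>2"
    unfolding int(2)[OF meas(2)] power_mult_distrib integral_mult_right_zero m2 by simp
  moreover have "(\<integral>x. iexp (Z x) \<partial>M) = char std_normal_distribution \<sigma>"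
    unfolding int(2)[OF meas(4)] char_def ..
  ultimately show "(\<integral>x. iexp (Z x) \<partial>M) = complex_of_real (exp (- (\<integral>x. (Z x)\<^sup>2 \<partial>M) / 2))"
    by (simp add: char_std_normal_distribution)
qed

section \<open>Second-order expansion of the softmax\<close>

text \<open>Along the ray s * v, the function is (up to a constant) the cumulant generating function
  of v under the weights \<open>p\<close>. Its first two derivatives at 0 are mean and variance, and
  its third derivative is a third cumulant under tilted weights, bounded uniformly in s. The factor
  1/4 is the Taylor factor 1/2 times the 1/2 in: variance = 1/2 of the mean squared difference of
  two independent draws.\<close>

lemma ln_sum_exp_taylor:
  fixes a v :: "'i \<Rightarrow> real"
  assumes I: "finite I" "I \<noteq> {}" and a: "\<And>i. i \<in> I \<Longrightarrow> a i > 0"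
  defines "p \<equiv> \<lambda>i. a i / (\<Sum>j\<in>I. a j)"
  shows "\<bar>ln (\<Sum>i\<in>I. a i * exp (v i)) - ln (\<Sum>i\<in>I. a i) - (\<Sum>i\<in>I. p i * v i)
     - (\<Sum>i\<in>I. \<Sum>j\<in>I. p i * p j * (v i - v j)\<^sup>2) / 4\<bar> \<le> (\<Sum>i\<in>I. \<bar>v i\<bar>^3)"
proof -
  \<comment> \<open>Unnormalized moments under the weights tilted by exp (s * v): differentiating in
    s raises \<open>k\<close> by one, and \<open>S k s / S 0 s\<close> is the k-th tilted
    moment.\<close>
  define S where "S k s = (\<Sum>i\<in>I. a i * v i ^ k * exp (s * v i))" for k s
  have S0: "S 0 s > 0" for s
    unfolding S_def using I a by (intro sum_pos) auto
  have dS: "(S k has_real_derivative S (Suc k) s) (at s)" for k s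
    unfolding S_def by (auto intro!: derivative_eq_intros sum.cong)
  \<comment> \<open>The derivatives up to order three as cumulants in terms of the tilted moments;
    only the indices 0 to 3 are ever used.\<close>
  define d where "d n = (if n = 0 then (\<lambda>s. ln (S 0 s))
     else if n = 1 then (\<lambda>s. S 1 s / S 0 s)
     else if n = 2 then (\<lambda>s. S 2 s / S 0 s - (S 1 s / S 0 s)\<^sup>2)
     else (\<lambda>s. S 3 s / S 0 s - 3 * (S 1 s / S 0 s) * (S 2 s / S 0 s) + 2 * (S 1 s / S 0 s)^3))" for n :: nat
  have d0: "(d 0 has_real_derivative d 1 s) (at s)" for s
    unfolding d_def using S0[of s] dS[of 0 s] by (auto intro!: derivative_eq_intros)
  have d1: "(d 1 has_real_derivative d 2 s) (at s)" for s
  proof -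
    have "((\<lambda>s. S 1 s / S 0 s) has_real_derivative S 2 s / S 0 s - (S 1 s / S 0 s)\<^sup>2) (at s)"
      using S0[of s] by (rule_tac DERIV_cong[OF DERIV_divide[OF dS dS]])
        (auto simp: field_simps power2_eq_square numeral_2_eq_2)
    then show ?thesis by (simp add: d_def)
  qed
  have d2: "(d 2 has_real_derivative d 3 s) (at s)" for s
  proof -
    have "((\<lambda>s. S 2 s / S 0 s - (S 1 s / S 0 s)\<^sup>2) has_real_derivative
       S 3 s / S 0 s - 3 * (S 1 s / S 0 s) * (S 2 s / S 0 s) + 2 * (S 1 s / S 0 s)^3) (at s)"
      using S0[of s]
      by (rule_tac DERIV_cong[OF DERIV_diff[OF DERIV_divide[OF dS dS] DERIV_power[OF DERIV_divide[OF dS dS]]]])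
        (auto simp: field_simps power2_eq_square power3_eq_cube numeral_2_eq_2 numeral_3_eq_3)
    then show ?thesis by (simp add: d_def)
  qed
  have "(d m has_real_derivative d (Suc m) s) (at s)" if "m < 3" for m s
  proof -
    from that consider "m = 0" | "m = 1" | "m = 2" by linarith
    then show ?thesis
    proof cases
      case 1 then have "Suc m = 1" by simp
      with 1 d0 show ?thesis by metis
    next
      case 2 then have "Suc m = 2" by simp
      with 2 d1 show ?thesis by metis
    next
      case 3 then have "Suc m = 3" by simp
      with 3 d2 show ?thesis by metis
    qed
  qed
  then have "\<exists>t::real. 0 < t \<and> t < 1 \<and> d 0 1 = (\<Sum>m<3. d m 0 / fact m * 1 ^ m) + d 3 t / fact 3 * 1 ^ 3"
    by (intro Maclaurin) auto
  then obtain t :: real where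
    t: "d 0 1 = (\<Sum>m<3. d m 0 / fact m * 1 ^ m) + d 3 t / fact 3 * 1 ^ 3" by blast
  then have T: "d 0 1 - d 0 0 - d 1 0 - d 2 0 / 2 = d 3 t / 6"
  proof -
    have "{..<3::nat} = {0, 1, 2}" by auto
    with t show ?thesis by (simp add: fact_numeral)
  qed
  have sp: "sum p I = 1"
    using S0[of 0] unfolding p_def sum_divide_distrib[symmetric] S_def by simp
  have pk: "S k 0 / S 0 0 = (\<Sum>i\<in>I. p i * v i ^ k)" for k
    by (simp add: S_def p_def sum_divide_distrib)
  have "(\<Sum>i\<in>I. \<Sum>j\<in>I. p i * p j * (v i - v j)\<^sup>2)
      = (\<Sum>i\<in>I. \<Sum>j\<in>I. p j * (p i * (v i)\<^sup>2) + p i * (p j * (v j)\<^sup>2) - 2 * ((p i * v i) * (p j * v j)))"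
    by (intro sum.cong refl) (simp add: power2_eq_square algebra_simps)
  also have "\<dots> = 2 * (\<Sum>i\<in>I. p i * v i ^ 2) - 2 * (\<Sum>i\<in>I. p i * v i)\<^sup>2"
    by (simp add: sum.distrib sum_subtractf sum_distrib_left[symmetric] sum_distrib_right[symmetric] sp
        power2_eq_square)
  finally have var: "(\<Sum>i\<in>I. \<Sum>j\<in>I. p i * p j * (v i - v j)\<^sup>2) / 4 = d 2 0 / 2"
    using pk[of 1] pk[of 2] by (simp add: d_def)
  have lhs: "ln (\<Sum>i\<in>I. a i * exp (v i)) - ln (\<Sum>i\<in>I. a i) - (\<Sum>i\<in>I. p i * v i)
     - (\<Sum>i\<in>I. \<Sum>j\<in>I. p i * p j * (v i - v j)\<^sup>2) / 4 = d 3 t / 6"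
    unfolding T[symmetric] var using pk[of 1] by (simp add: d_def S_def)
  define K where "K = Max ((\<lambda>i. \<bar>v i\<bar>) ` I)"
  have K: "\<bar>v i\<bar> \<le> K" if "i \<in> I" for i
    unfolding K_def using I that by auto
  obtain j where j: "j \<in> I" "K = \<bar>v j\<bar>"
    using Max_in[of "(\<lambda>i. \<bar>v i\<bar>) ` I"] I unfolding K_def by blast
  \<comment> \<open>A tilted moment is a weighted average of powers of the \<open>v i\<close>, so
    the bound does not depend on the unknown Taylor point \<open>t\<close>.\<close>
  have bd: "\<bar>S k t / S 0 t\<bar> \<le> K ^ k" for k
  proof -
    have "\<bar>S k t\<bar> \<le> (\<Sum>i\<in>I. \<bar>a i * v i ^ k * exp (t * v i)\<bar>)"
      unfolding S_def by (rule sum_abs)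
    also have "\<dots> \<le> (\<Sum>i\<in>I. a i * K ^ k * exp (t * v i))"
    proof (rule sum_mono)
      fix i assume i: "i \<in> I"
      have "\<bar>v i\<bar> ^ k \<le> K ^ k" using K[OF i] by (intro power_mono) auto
      then show "\<bar>a i * v i ^ k * exp (t * v i)\<bar> \<le> a i * K ^ k * exp (t * v i)"
        using a[OF i] by (simp add: abs_mult power_abs)
    qed
    also have "\<dots> = K ^ k * S 0 t"
      unfolding S_def by (simp add: sum_distrib_left mult_ac)
    finally show ?thesis using S0[of t] by (simp add: field_simps)
  qed
  \<comment> \<open>The coefficients 1 + 3 + 2 = 6 will cancel the 3! of the Taylor remainder, which
    leaves the constant 1 in the claim.\<close>
  have "\<bar>d 3 t\<bar> \<le> \<bar>S 3 t / S 0 t\<bar> + 3 * (\<bar>S 1 t / S 0 t\<bar> * \<bar>S 2 t / S 0 t\<bar>) + 2 * \<bar>S 1 t / S 0 t\<bar>^3"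
  proof -
    have "\<bar>x - 3 * y * z + 2 * y^3\<bar> \<le> \<bar>x\<bar> + 3 * (\<bar>y\<bar> * \<bar>z\<bar>) + 2 * \<bar>y\<bar>^3" for x y z :: real
      unfolding abs_mult[symmetric] power_abs[symmetric] by (simp add: mult.assoc)
    moreover have "d 3 t = S 3 t / S 0 t - 3 * (S 1 t / S 0 t) * (S 2 t / S 0 t) + 2 * (S 1 t / S 0 t)^3"
      by (simp add: d_def)
    ultimately show ?thesis by metis
  qed
  also have "\<dots> \<le> K^3 + 3 * (K^1 * K^2) + 2 * (K^1)^3"
    using j(2) by (intro add_mono mult_mono power_mono bd order_refl) auto
  also have "\<dots> = 6 * K^3" by (simp add: power2_eq_square power3_eq_cube)
  also have "K^3 \<le> (\<Sum>i\<in>I. \<bar>v i\<bar>^3)"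
    unfolding j(2) using I j(1) by (intro member_le_sum) auto
  finally show ?thesis unfolding lhs by simp
qed

section \<open>Uniqueness of finite-dimensional laws\<close>

text \<open>Levy uniqueness speaks of probability laws; a nonnegative weight of positive total mass
  is therefore normalized to a density and pushed forward by \<open>W\<close>.\<close>

lemma normalized_weighted_distr:
  fixes f W :: "'a \<Rightarrow> real"
  assumes [measurable]: "W \<in> borel_measurable M"
    and f: "integrable M f" "\<And>x. 0 \<le> f x" and K: "(\<integral>x. f x \<partial>M) = K" "K > 0"
  obtains \<mu> where "real_distribution \<mu>"
    "\<And>s. char \<mu> s = (\<integral>x. complex_of_real (f x) * iexp (s * W x) \<partial>M) / K"
    "\<And>B. B \<in> sets borel \<Longrightarrow> measure \<mu> B = (\<integral>x. f x * indicator B (W x) \<partial>M) / K"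
proof
  have [measurable]: "f \<in> borel_measurable M" using f by auto
  define \<mu> where "\<mu> = distr (density M (\<lambda>x. ennreal (f x / K))) borel W"
  have "(\<integral>\<^sup>+x. ennreal (f x / K) \<partial>M) = 1"
    using f K by (subst nn_integral_eq_integral) auto
  then have "emeasure (density M (\<lambda>x. ennreal (f x / K))) (space (density M (\<lambda>x. ennreal (f x / K)))) = 1"
    by (simp add: emeasure_density cong: nn_integral_cong_simp)
  then have ps: "prob_space (density M (\<lambda>x. ennreal (f x / K)))"
    by (intro prob_spaceI)
  show R: "real_distribution \<mu>"
    unfolding \<mu>_def real_distribution_def real_distribution_axioms_def
    by (auto intro!: prob_space.prob_space_distr[OF ps])
  show "char \<mu> s = (\<integral>x. complex_of_real (f x) * iexp (s * W x) \<partial>M) / K" for s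
  proof -
    have "char \<mu> s = (\<integral>x. (f x / K) *\<^sub>R iexp (s * W x) \<partial>M)"
      unfolding \<mu>_def char_def using K f
      by (subst integral_distr, measurable) (simp add: integral_density)
    also have "\<dots> = (\<integral>x. complex_of_real (f x) * iexp (s * W x) / K \<partial>M)"
      by (intro Bochner_Integration.integral_cong) (auto simp: scaleR_conv_of_real)
    finally show ?thesis by simp
  qed
  interpret real_distribution \<mu> by fact
  show "measure \<mu> B = (\<integral>x. f x * indicator B (W x) \<partial>M) / K" if [measurable]: "B \<in> sets borel" for B
  proof -
    have "measure \<mu> B = (\<integral>x. indicator B x \<partial>\<mu>)"
      by (simp add: \<mu>_def)
    also have "\<dots> = (\<integral>x. (f x / K) *\<^sub>R indicator B (W x) \<partial>M)"
      unfolding \<mu>_def using K f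
      by (subst integral_distr, measurable) (simp add: integral_density)
    finally show ?thesis by simp
  qed
qed

text \<open>The hypothesis equates the Fourier transforms of two finite positive measures on the
  line. At s = 0 it says that their masses agree, so both are normalized by the same
  \<open>K\<close>; for mass 0 both weights vanish almost everywhere.\<close>

lemma weighted_indicator_eqI:
  fixes U u :: "'a \<Rightarrow> real" and V w :: "'b \<Rightarrow> real"
  assumes [measurable]: "U \<in> borel_measurable M" "V \<in> borel_measurable N"
    and u: "integrable M u" "\<And>x. 0 \<le> u x" and w: "integrable N w" "\<And>x. 0 \<le> w x"
    and eq: "\<And>s. (\<integral>x. complex_of_real (u x) * iexp (s * U x) \<partial>M) = (\<integral>x. complex_of_real (w x) * iexp (s * V x) \<partial>N)"
    and B: "B \<in> sets borel"
  shows "(\<integral>x. u x * indicator B (U x) \<partial>M) = (\<integral>x. w x * indicator B (V x) \<partial>N)"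
proof -
  have [measurable]: "u \<in> borel_measurable M" "w \<in> borel_measurable N"
    using u w by auto
  define K where "K = (\<integral>x. u x \<partial>M)"
  have KN: "(\<integral>x. w x \<partial>N) = K"
    using eq[of 0] by (simp add: K_def)
  show ?thesis
  proof (cases "K = 0")
    case True
    have "AE x in M. u x = 0" "AE x in N. w x = 0"
      using True KN K_def[symmetric] integral_nonneg_eq_0_iff_AE[OF u(1)] integral_nonneg_eq_0_iff_AE[OF w(1)] u(2) w(2)
      by simp_all
    then have "(\<integral>x. u x * indicator B (U x) \<partial>M) = 0" "(\<integral>x. w x * indicator B (V x) \<partial>N) = 0"
      by (auto intro!: integral_eq_zero_AE)
    then show ?thesis by simp
  next
    case False
    have "K \<ge> 0" unfolding K_def using u by simp
    with False have K: "K > 0" by simp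
    obtain \<mu> where \<mu>: "real_distribution \<mu>"
      "\<And>s. char \<mu> s = (\<integral>x. complex_of_real (u x) * iexp (s * U x) \<partial>M) / K"
      "measure \<mu> B = (\<integral>x. u x * indicator B (U x) \<partial>M) / K"
      using normalized_weighted_distr[OF assms(1) u K_def[symmetric] K] B by metis
    obtain \<nu> where \<nu>: "real_distribution \<nu>"
      "\<And>s. char \<nu> s = (\<integral>x. complex_of_real (w x) * iexp (s * V x) \<partial>N) / K"
      "measure \<nu> B = (\<integral>x. w x * indicator B (V x) \<partial>N) / K"
      using normalized_weighted_distr[OF assms(2) w KN K] B by metis
    have "\<mu> = \<nu>"
      by (intro Levy_uniqueness \<mu>(1) \<nu>(1)) (intro ext, simp only: \<mu>(2) \<nu>(2) eq)
    with \<mu>(3) \<nu>(3) K show ?thesis by simp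
  qed
qed

text \<open>By Euler's formulas a factor cos or sin only shifts the frequency, so these tilted
  transforms are combinations of transforms with the weight \<open>b\<close>. The added 1 keeps the
  weight nonnegative whenever \<open>b\<close> is, as Levy uniqueness for measures requires.\<close>

lemma tilted_iexp_integral:
  fixes P :: "'a measure" and A W b :: "'a \<Rightarrow> real"
  assumes "prob_space P" and [measurable]: "A \<in> borel_measurable P" "W \<in> borel_measurable P" "b \<in> borel_measurable P"
    and b: "\<And>x. \<bar>b x\<bar> \<le> 1"
  shows "(\<integral>x. complex_of_real (b x * (1 + cos (A x))) * iexp (W x) \<partial>P)
      = (\<integral>x. complex_of_real (b x) * iexp (W x) \<partial>P)
      + ((\<integral>x. complex_of_real (b x) * iexp (A x + W x) \<partial>P) + (\<integral>x. complex_of_real (b x) * iexp (- A x + W x) \<partial>P)) / 2"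
    and "(\<integral>x. complex_of_real (b x * (1 + sin (A x))) * iexp (W x) \<partial>P)
      = (\<integral>x. complex_of_real (b x) * iexp (W x) \<partial>P)
      + ((\<integral>x. complex_of_real (b x) * iexp (A x + W x) \<partial>P) - (\<integral>x. complex_of_real (b x) * iexp (- A x + W x) \<partial>P)) / (2 * \<i>)"
proof -
  interpret prob_space P by fact
  have int: "integrable P (\<lambda>x. complex_of_real (b x) * iexp (f x))" if [measurable]: "f \<in> borel_measurable P" for f
    using b by (intro integrable_const_bound[of _ 1]) (auto simp: norm_mult)
  have c: "complex_of_real (b x * (1 + cos (A x))) * iexp (W x) = complex_of_real (b x) * iexp (W x)
      + (complex_of_real (b x) * iexp (A x + W x) + complex_of_real (b x) * iexp (- A x + W x)) / 2"
    and s: "complex_of_real (b x * (1 + sin (A x))) * iexp (W x) = complex_of_real (b x) * iexp (W x)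
      + (complex_of_real (b x) * iexp (A x + W x) - complex_of_real (b x) * iexp (- A x + W x)) / (2 * \<i>)" for x
  proof -
    have e: "iexp (y + z) = iexp y * iexp z" for y z
      by (simp add: exp_add distrib_left)
    have cs: "complex_of_real (cos y) = (iexp y + iexp (- y)) / 2"
      "complex_of_real (sin y) = (iexp y - iexp (- y)) / (2 * \<i>)" for y
      by (simp_all add: cos_exp_eq sin_exp_eq flip: cos_of_real sin_of_real)
    show "complex_of_real (b x * (1 + cos (A x))) * iexp (W x) = complex_of_real (b x) * iexp (W x)
      + (complex_of_real (b x) * iexp (A x + W x) + complex_of_real (b x) * iexp (- A x + W x)) / 2"
      "complex_of_real (b x * (1 + sin (A x))) * iexp (W x) = complex_of_real (b x) * iexp (W x)
      + (complex_of_real (b x) * iexp (A x + W x) - complex_of_real (b x) * iexp (- A x + W x)) / (2 * \<i>)"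
      unfolding e unfolding of_real_mult of_real_add cs by (simp_all add: field_simps)
  qed
  have [measurable]: "(\<lambda>x. A x + W x) \<in> borel_measurable P" "(\<lambda>x. - A x + W x) \<in> borel_measurable P"
    by measurable
  note i = int[OF assms(3)] int[OF \<open>(\<lambda>x. A x + W x) \<in> borel_measurable P\<close>] int[OF \<open>(\<lambda>x. - A x + W x) \<in> borel_measurable P\<close>]
  show "(\<integral>x. complex_of_real (b x * (1 + cos (A x))) * iexp (W x) \<partial>P)
      = (\<integral>x. complex_of_real (b x) * iexp (W x) \<partial>P)
      + ((\<integral>x. complex_of_real (b x) * iexp (A x + W x) \<partial>P) + (\<integral>x. complex_of_real (b x) * iexp (- A x + W x) \<partial>P)) / 2"
    unfolding c using i by (simp del: of_real_add of_real_minus)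
  show "(\<integral>x. complex_of_real (b x * (1 + sin (A x))) * iexp (W x) \<partial>P)
      = (\<integral>x. complex_of_real (b x) * iexp (W x) \<partial>P)
      + ((\<integral>x. complex_of_real (b x) * iexp (A x + W x) \<partial>P) - (\<integral>x. complex_of_real (b x) * iexp (- A x + W x) \<partial>P)) / (2 * \<i>)"
    unfolding s using i by (simp del: of_real_add of_real_minus)
qed

lemma emeasure_distr_prod_emb:
  fixes Z :: "'i \<Rightarrow> 'a \<Rightarrow> real"
  assumes "prob_space P" and Z: "\<And>i. i \<in> I \<Longrightarrow> Z i \<in> borel_measurable P"
    and J: "finite J" "J \<subseteq> I" and A: "\<And>i. i \<in> J \<Longrightarrow> A i \<in> sets borel" and B: "\<And>i. i \<in> J \<Longrightarrow> B i = A i"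
  shows "emeasure (distr P (PiM I (\<lambda>_. borel)) (\<lambda>\<omega>. \<lambda>i\<in>I. Z i \<omega>)) (prod_emb I (\<lambda>_. borel) J (PiE J A))
      = ennreal (\<integral>\<omega>. (\<Prod>j\<in>J. indicator (B j) (Z j \<omega>)) \<partial>P)"
proof -
  interpret prob_space P by fact
  have [measurable]: "(\<lambda>\<omega>. \<lambda>i\<in>I. Z i \<omega>) \<in> measurable P (PiM I (\<lambda>_. borel))"
    using Z by (auto intro!: measurable_restrict)
  have E: "prod_emb I (\<lambda>_. borel :: real measure) J (PiE J A) \<in> sets (PiM I (\<lambda>_. borel))"
    using J A by (intro sets_PiM_I) auto
  define S where "S = (\<lambda>\<omega>. \<lambda>i\<in>I. Z i \<omega>) -` prod_emb I (\<lambda>_. borel) J (PiE J A) \<inter> space P"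
  have S: "S \<in> sets P" unfolding S_def using E by measurable
  have "indicator S \<omega> = (\<Prod>j\<in>J. indicator (B j) (Z j \<omega>) :: real)" if "\<omega> \<in> space P" for \<omega>
  proof -
    have "\<omega> \<in> S \<longleftrightarrow> (\<forall>j\<in>J. Z j \<omega> \<in> B j)"
      using that J B by (auto simp: S_def prod_emb_def PiE_iff subset_iff)
    then show ?thesis using J by (auto simp: indicator_def)
  qed
  then have "(\<integral>\<omega>. (\<Prod>j\<in>J. indicator (B j) (Z j \<omega>)) \<partial>P) = (\<integral>\<omega>. indicator S \<omega> \<partial>P :: real)"
    by (intro Bochner_Integration.integral_cong) auto
  also have "\<dots> = measure P S" using S by simp
  finally show ?thesis
    using E by (simp add: emeasure_distr S_def emeasure_eq_measure)
qed

text \<open>The Cramer-Wold principle. Boxes determine a measure on the product space, and box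
  probabilities are the case of zero frequency in a mixed identity in which some coordinates carry
  indicators and the linear combination sits in the exponential.\<close>

lemma distr_PiM_eqI_iexp:
  fixes X :: "'i \<Rightarrow> 'a \<Rightarrow> real" and Y :: "'i \<Rightarrow> 'b \<Rightarrow> real"
  assumes "prob_space M" "prob_space N" "finite I"
    and X: "\<And>i. i \<in> I \<Longrightarrow> X i \<in> borel_measurable M" and Y: "\<And>i. i \<in> I \<Longrightarrow> Y i \<in> borel_measurable N"
    and eq: "\<And>c. (\<integral>\<omega>. iexp (\<Sum>i\<in>I. c i * X i \<omega>) \<partial>M) = (\<integral>\<omega>. iexp (\<Sum>i\<in>I. c i * Y i \<omega>) \<partial>N)"
  shows "distr M (PiM I (\<lambda>_. borel)) (\<lambda>\<omega>. \<lambda>i\<in>I. X i \<omega>) = distr N (PiM I (\<lambda>_. borel)) (\<lambda>\<omega>. \<lambda>i\<in>I. Y i \<omega>)"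
proof -
  interpret M: prob_space M by fact
  interpret N: prob_space N by fact
  have mX: "(\<lambda>\<omega>. \<Prod>j\<in>J. indicator (B j) (X j \<omega>) :: real) \<in> borel_measurable M"
    and mY: "(\<lambda>\<omega>. \<Prod>j\<in>J. indicator (B j) (Y j \<omega>) :: real) \<in> borel_measurable N"
    if [measurable]: "\<And>j. B j \<in> sets borel" and J: "J \<subseteq> I" for J and B :: "'i \<Rightarrow> real set"
  proof -
    have *: "X j \<in> borel_measurable M" "Y j \<in> borel_measurable N" if "j \<in> J" for j using X Y J that by auto
    show "(\<lambda>\<omega>. \<Prod>j\<in>J. indicator (B j) (X j \<omega>) :: real) \<in> borel_measurable M"
      "(\<lambda>\<omega>. \<Prod>j\<in>J. indicator (B j) (Y j \<omega>) :: real) \<in> borel_measurable N"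
      by (intro borel_measurable_prod borel_measurable_indicator' measurable_sets_borel; use * in measurable)+
  qed
  have lX: "(\<lambda>\<omega>. \<Sum>i\<in>I. c i * X i \<omega>) \<in> borel_measurable M"
    and lY: "(\<lambda>\<omega>. \<Sum>i\<in>I. c i * Y i \<omega>) \<in> borel_measurable N" for c :: "'i \<Rightarrow> real"
    using X Y by (auto intro!: borel_measurable_sum borel_measurable_times)
  have ind: "0 \<le> (\<Prod>j\<in>J. indicator (B j) (f j) :: real)" "\<bar>\<Prod>j\<in>J. indicator (B j) (f j) :: real\<bar> \<le> 1"
    for J and B :: "'i \<Rightarrow> real set" and f
    by (auto simp: abs_prod intro!: prod_nonneg prod_le_1)
  \<comment> \<open>Indicators replace exponentials one coordinate at a time: Levy's theorem applies to the positive
    measures with weights \<open>b\<close>, \<open>b (1 + cos S)\<close> and \<open>b (1 + sin S)\<close>.\<close>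
  have main: "(\<integral>\<omega>. complex_of_real (\<Prod>j\<in>J. indicator (B j) (X j \<omega>)) * iexp (\<Sum>i\<in>I. c i * X i \<omega>) \<partial>M)
      = (\<integral>\<omega>. complex_of_real (\<Prod>j\<in>J. indicator (B j) (Y j \<omega>)) * iexp (\<Sum>i\<in>I. c i * Y i \<omega>) \<partial>N)"
    if B: "\<And>j. B j \<in> sets borel" and J: "finite J" "J \<subseteq> I" for J and c :: "'i \<Rightarrow> real" and B :: "'i \<Rightarrow> real set"
    using J
  proof (induction J arbitrary: c rule: finite_induct)
    case empty
    then show ?case using eq[of c] by simp
  next
    case (insert k J)
    define b where "b \<omega> = (\<Prod>j\<in>J. indicator (B j) (X j \<omega>) :: real)" for \<omega>
    define d where "d \<omega> = (\<Prod>j\<in>J. indicator (B j) (Y j \<omega>) :: real)" for \<omega>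
    define S where "S \<omega> = (\<Sum>i\<in>I. c i * X i \<omega>)" for \<omega>
    define T where "T \<omega> = (\<Sum>i\<in>I. c i * Y i \<omega>)" for \<omega>
    have kI: "k \<in> I" and JI: "J \<subseteq> I" using insert.prems by auto
    have meas [measurable]: "b \<in> borel_measurable M" "d \<in> borel_measurable N"
      "S \<in> borel_measurable M" "T \<in> borel_measurable N" "X k \<in> borel_measurable M" "Y k \<in> borel_measurable N"
      unfolding b_def d_def S_def T_def using mX[OF B JI] mY[OF B JI] lX lY X Y kI by auto
    note [measurable] = B
    have sm: "(\<lambda>\<omega>. s * X k \<omega>) \<in> borel_measurable M" "(\<lambda>\<omega>. s * Y k \<omega>) \<in> borel_measurable N" for s
      by measurable
    have bd: "0 \<le> b \<omega>" "\<bar>b \<omega>\<bar> \<le> 1" "0 \<le> d \<omega>'" "\<bar>d \<omega>'\<bar> \<le> 1" for \<omega> \<omega>'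
      unfolding b_def d_def by (rule ind)+
    \<comment> \<open>The induction hypothesis holds for all coefficients, so changing the one at
      \<open>k\<close> makes a free multiple of \<open>X k\<close> available next to
      \<open>S\<close>.\<close>
    have shift: "(\<Sum>i\<in>I. (r * c i + (if i = k then s else 0)) * x i) = r * (\<Sum>i\<in>I. c i * x i) + s * x k" for r s x
      using kI \<open>finite I\<close> by (simp add: distrib_right sum.distrib sum_distrib_left mult.assoc if_distrib[of "\<lambda>a. a * _"] cong: if_cong)
    have IH: "(\<integral>\<omega>. complex_of_real (b \<omega>) * iexp (r * S \<omega> + s * X k \<omega>) \<partial>M)
        = (\<integral>\<omega>. complex_of_real (d \<omega>) * iexp (r * T \<omega> + s * Y k \<omega>) \<partial>N)" for r s
      using insert.IH[OF JI, of "\<lambda>i. r * c i + (if i = k then s else 0)"]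
      unfolding shift b_def d_def S_def T_def .
    \<comment> \<open>The multiples 0, 1 and -1 of \<open>S\<close> are exactly the ones produced by
      Euler's formulas for the weights with cos and sin.\<close>
    have IHs: "(\<integral>\<omega>. complex_of_real (b \<omega>) * iexp (s * X k \<omega>) \<partial>M) = (\<integral>\<omega>. complex_of_real (d \<omega>) * iexp (s * Y k \<omega>) \<partial>N)"
      "(\<integral>\<omega>. complex_of_real (b \<omega>) * iexp (S \<omega> + s * X k \<omega>) \<partial>M) = (\<integral>\<omega>. complex_of_real (d \<omega>) * iexp (T \<omega> + s * Y k \<omega>) \<partial>N)"
      "(\<integral>\<omega>. complex_of_real (b \<omega>) * iexp (- S \<omega> + s * X k \<omega>) \<partial>M) = (\<integral>\<omega>. complex_of_real (d \<omega>) * iexp (- T \<omega> + s * Y k \<omega>) \<partial>N)"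
      for s using IH[of 0 s] IH[of 1 s] IH[of "-1" s] by simp_all
    have bint: "integrable M (\<lambda>\<omega>. b \<omega> * f \<omega>)" if [measurable]: "f \<in> borel_measurable M" and "\<And>x. \<bar>f x\<bar> \<le> 2" for f
      by (intro M.integrable_const_bound[of _ "1 * 2"] AE_I2)
        (use mult_mono[OF bd(2) that(2)] in \<open>auto simp: abs_mult\<close>)
    have dint: "integrable N (\<lambda>\<omega>. d \<omega> * f \<omega>)" if [measurable]: "f \<in> borel_measurable N" and "\<And>x. \<bar>f x\<bar> \<le> 2" for f
      by (intro N.integrable_const_bound[of _ "1 * 2"] AE_I2)
        (use mult_mono[OF bd(4) that(2)] in \<open>auto simp: abs_mult\<close>)
    have cs: "\<bar>1 + cos x\<bar> \<le> 2" "\<bar>1 + sin x\<bar> \<le> 2" "0 \<le> 1 + cos x" "0 \<le> 1 + sin x" for x :: real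
      using abs_cos_le_one[of x] abs_sin_le_one[of x] unfolding abs_le_iff by linarith+
    have tm: "(\<lambda>\<omega>. 1 + cos (S \<omega>)) \<in> borel_measurable M" "(\<lambda>\<omega>. 1 + sin (S \<omega>)) \<in> borel_measurable M"
      "(\<lambda>\<omega>. 1 + cos (T \<omega>)) \<in> borel_measurable N" "(\<lambda>\<omega>. 1 + sin (T \<omega>)) \<in> borel_measurable N"
      by measurable
    have E1: "(\<integral>\<omega>. b \<omega> * 1 * indicator (B k) (X k \<omega>) \<partial>M) = (\<integral>\<omega>. d \<omega> * 1 * indicator (B k) (Y k \<omega>) \<partial>N)"
      by (rule weighted_indicator_eqI) (use bint[of "\<lambda>_. 1"] dint[of "\<lambda>_. 1"] bd IHs B in auto)
    have Ec: "(\<integral>\<omega>. b \<omega> * (1 + cos (S \<omega>)) * indicator (B k) (X k \<omega>) \<partial>M) = (\<integral>\<omega>. d \<omega> * (1 + cos (T \<omega>)) * indicator (B k) (Y k \<omega>) \<partial>N)"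
    proof (rule weighted_indicator_eqI[OF meas(5,6) bint[OF tm(1) cs(1)] mult_nonneg_nonneg[OF bd(1) cs(3)]
          dint[OF tm(3) cs(1)] mult_nonneg_nonneg[OF bd(3) cs(3)] _ B])
      show "(\<integral>x. complex_of_real (b x * (1 + cos (S x))) * iexp (s * X k x) \<partial>M) =
         (\<integral>x. complex_of_real (d x * (1 + cos (T x))) * iexp (s * Y k x) \<partial>N)" for s
        unfolding tilted_iexp_integral(1)[OF assms(1) meas(3) sm(1) meas(1) bd(2)]
          tilted_iexp_integral(1)[OF assms(2) meas(4) sm(2) meas(2) bd(4)] IHs ..
    qed
    have Es: "(\<integral>\<omega>. b \<omega> * (1 + sin (S \<omega>)) * indicator (B k) (X k \<omega>) \<partial>M) = (\<integral>\<omega>. d \<omega> * (1 + sin (T \<omega>)) * indicator (B k) (Y k \<omega>) \<partial>N)"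
    proof (rule weighted_indicator_eqI[OF meas(5,6) bint[OF tm(2) cs(2)] mult_nonneg_nonneg[OF bd(1) cs(4)]
          dint[OF tm(4) cs(2)] mult_nonneg_nonneg[OF bd(3) cs(4)] _ B])
      show "(\<integral>x. complex_of_real (b x * (1 + sin (S x))) * iexp (s * X k x) \<partial>M) =
         (\<integral>x. complex_of_real (d x * (1 + sin (T x))) * iexp (s * Y k x) \<partial>N)" for s
        unfolding tilted_iexp_integral(2)[OF assms(1) meas(3) sm(1) meas(1) bd(2)]
          tilted_iexp_integral(2)[OF assms(2) meas(4) sm(2) meas(2) bd(4)] IHs ..
    qed
    have bi: "integrable M (\<lambda>\<omega>. b \<omega> * indicator (B k) (X k \<omega>) * f \<omega>)" if [measurable]: "f \<in> borel_measurable M" and "\<And>x. \<bar>f x\<bar> \<le> 1" for f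
    proof -
      have "\<bar>indicator (B k) (X k \<omega>) * f \<omega>\<bar> \<le> 2" for \<omega>
        using that(2)[of \<omega>] by (auto simp: indicator_def)
      from bint[OF _ this] show ?thesis by (simp add: mult.assoc)
    qed
    have di: "integrable N (\<lambda>\<omega>. d \<omega> * indicator (B k) (Y k \<omega>) * f \<omega>)" if [measurable]: "f \<in> borel_measurable N" and "\<And>x. \<bar>f x\<bar> \<le> 1" for f
    proof -
      have "\<bar>indicator (B k) (Y k \<omega>) * f \<omega>\<bar> \<le> 2" for \<omega>
        using that(2)[of \<omega>] by (auto simp: indicator_def)
      from dint[OF _ this] show ?thesis by (simp add: mult.assoc)
    qed
    \<comment> \<open>Subtracting \<open>E1\<close> removes the 1 that had been added for positivity
      and leaves the pure cosine and sine integrals.\<close>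
    have bsplit: "(\<integral>\<omega>. b \<omega> * (1 + f \<omega>) * indicator (B k) (X k \<omega>) \<partial>M)
        = (\<integral>\<omega>. b \<omega> * 1 * indicator (B k) (X k \<omega>) \<partial>M) + (\<integral>\<omega>. b \<omega> * indicator (B k) (X k \<omega>) * f \<omega> \<partial>M)"
      if "f \<in> borel_measurable M" "\<And>x. \<bar>f x\<bar> \<le> 1" for f
      using bi[OF that] bi[of "\<lambda>_. 1"]
      by (subst Bochner_Integration.integral_add[symmetric]) (auto simp: algebra_simps)
    have dsplit: "(\<integral>\<omega>. d \<omega> * (1 + f \<omega>) * indicator (B k) (Y k \<omega>) \<partial>N)
        = (\<integral>\<omega>. d \<omega> * 1 * indicator (B k) (Y k \<omega>) \<partial>N) + (\<integral>\<omega>. d \<omega> * indicator (B k) (Y k \<omega>) * f \<omega> \<partial>N)"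
      if "f \<in> borel_measurable N" "\<And>x. \<bar>f x\<bar> \<le> 1" for f
      using di[OF that] di[of "\<lambda>_. 1"]
      by (subst Bochner_Integration.integral_add[symmetric]) (auto simp: algebra_simps)
    have trig [measurable]: "(\<lambda>\<omega>. cos (S \<omega>)) \<in> borel_measurable M" "(\<lambda>\<omega>. sin (S \<omega>)) \<in> borel_measurable M"
      "(\<lambda>\<omega>. cos (T \<omega>)) \<in> borel_measurable N" "(\<lambda>\<omega>. sin (T \<omega>)) \<in> borel_measurable N"
      by measurable
    have Ic: "(\<integral>\<omega>. b \<omega> * indicator (B k) (X k \<omega>) * cos (S \<omega>) \<partial>M) = (\<integral>\<omega>. d \<omega> * indicator (B k) (Y k \<omega>) * cos (T \<omega>) \<partial>N)"
      using Ec E1 bsplit[OF trig(1) abs_cos_le_one] dsplit[OF trig(3) abs_cos_le_one] by linarith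
    have Is: "(\<integral>\<omega>. b \<omega> * indicator (B k) (X k \<omega>) * sin (S \<omega>) \<partial>M) = (\<integral>\<omega>. d \<omega> * indicator (B k) (Y k \<omega>) * sin (T \<omega>) \<partial>N)"
      using Es E1 bsplit[OF trig(2) abs_sin_le_one] dsplit[OF trig(4) abs_sin_le_one] by linarith
    \<comment> \<open>Cosine and sine integrals, now containing the indicator of \<open>B k\<close>,
      are reassembled into the complex exponential.\<close>
    have decomp: "complex_of_real r * iexp x = of_real (r * cos x) + \<i> * of_real (r * sin x)" for r x
      by (simp add: exp_Euler cos_of_real sin_of_real algebra_simps)
    have bc: "(\<integral>\<omega>. complex_of_real (b \<omega> * indicator (B k) (X k \<omega>)) * iexp (S \<omega>) \<partial>M)
       = of_real (\<integral>\<omega>. b \<omega> * indicator (B k) (X k \<omega>) * cos (S \<omega>) \<partial>M)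
       + \<i> * of_real (\<integral>\<omega>. b \<omega> * indicator (B k) (X k \<omega>) * sin (S \<omega>) \<partial>M)"
      unfolding decomp
      using bi[OF trig(1) abs_cos_le_one] bi[OF trig(2) abs_sin_le_one]
      by (subst Bochner_Integration.integral_add) (auto simp del: of_real_mult)
    have dc: "(\<integral>\<omega>. complex_of_real (d \<omega> * indicator (B k) (Y k \<omega>)) * iexp (T \<omega>) \<partial>N)
       = of_real (\<integral>\<omega>. d \<omega> * indicator (B k) (Y k \<omega>) * cos (T \<omega>) \<partial>N)
       + \<i> * of_real (\<integral>\<omega>. d \<omega> * indicator (B k) (Y k \<omega>) * sin (T \<omega>) \<partial>N)"
      unfolding decomp
      using di[OF trig(3) abs_cos_le_one] di[OF trig(4) abs_sin_le_one]
      by (subst Bochner_Integration.integral_add) (auto simp del: of_real_mult)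
    have "(\<integral>\<omega>. complex_of_real (b \<omega> * indicator (B k) (X k \<omega>)) * iexp (S \<omega>) \<partial>M)
       = (\<integral>\<omega>. complex_of_real (d \<omega> * indicator (B k) (Y k \<omega>)) * iexp (T \<omega>) \<partial>N)"
      unfolding bc dc Ic Is ..
    moreover have "(\<Prod>j\<in>insert k J. indicator (B j) (X j \<omega>)) = b \<omega> * indicator (B k) (X k \<omega>)"
      "(\<Prod>j\<in>insert k J. indicator (B j) (Y j \<omega>')) = d \<omega>' * indicator (B k) (Y k \<omega>')" for \<omega> \<omega>'
      using insert.hyps by (simp_all add: b_def d_def mult.commute)
    ultimately show ?case by (simp add: S_def T_def)
  qed
  have [measurable]: "(\<lambda>\<omega>. \<lambda>i\<in>I. X i \<omega>) \<in> measurable M (PiM I (\<lambda>_. borel))"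
    "(\<lambda>\<omega>. \<lambda>i\<in>I. Y i \<omega>) \<in> measurable N (PiM I (\<lambda>_. borel))"
    using X Y by (auto intro!: measurable_restrict)
  show ?thesis
  proof (rule measure_eqI_PiM_infinite)
    fix A J assume J: "finite J" "J \<subseteq> I" and A: "\<And>i. i \<in> J \<Longrightarrow> A i \<in> sets (borel :: real measure)"
    \<comment> \<open>\<open>A\<close> is known to be Borel only on \<open>J\<close>, while
      \<open>main\<close> asks this of every index; \<open>UNIV\<close> is the harmless
      default.\<close>
    define B where "B i = (if i \<in> J then A i else UNIV)" for i
    have "emeasure (distr M (PiM I (\<lambda>_. borel)) (\<lambda>\<omega>. \<lambda>i\<in>I. X i \<omega>)) (prod_emb I (\<lambda>_. borel) J (PiE J A))
        = ennreal (\<integral>\<omega>. (\<Prod>j\<in>J. indicator (B j) (X j \<omega>)) \<partial>M)"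
      using A J X assms(1) by (intro emeasure_distr_prod_emb) (auto simp: B_def)
    also have "(\<integral>\<omega>. (\<Prod>j\<in>J. indicator (B j) (X j \<omega>)) \<partial>M) = (\<integral>\<omega>. (\<Prod>j\<in>J. indicator (B j) (Y j \<omega>)) \<partial>N :: real)"
    proof -
      have "B j \<in> sets borel" for j using A by (simp add: B_def)
      from main[of B J "\<lambda>_. 0", OF this J] show ?thesis
        by (simp del: of_real_prod)
    qed
    also have "ennreal \<dots> = emeasure (distr N (PiM I (\<lambda>_. borel)) (\<lambda>\<omega>. \<lambda>i\<in>I. Y i \<omega>)) (prod_emb I (\<lambda>_. borel) J (PiE J A))"
      using A J Y assms(2) by (intro emeasure_distr_prod_emb[symmetric]) (auto simp: B_def)
    finally show "emeasure (distr M (PiM I (\<lambda>_. borel)) (\<lambda>\<omega>. \<lambda>i\<in>I. X i \<omega>)) (prod_emb I (\<lambda>_. borel) J (PiE J A))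
       = emeasure (distr N (PiM I (\<lambda>_. borel)) (\<lambda>\<omega>. \<lambda>i\<in>I. Y i \<omega>)) (prod_emb I (\<lambda>_. borel) J (PiE J A))" .
  qed (auto intro!: prob_space.finite_measure M.prob_space_distr)
qed

section \<open>Expectations of the softmax\<close>

definition lse :: "'i set \<Rightarrow> ('i \<Rightarrow> real) \<Rightarrow> real" where
  "lse I x = ln (\<Sum>i\<in>I. exp (x i))"

text \<open>A sum of exponentials lies between its largest term and \<open>card I\<close> times that
  term.\<close>

lemma lse_bounds:
  assumes "finite I" "I \<noteq> {}"
  shows "Max (x ` I) \<le> lse I x" "lse I x \<le> Max (x ` I) + ln (card I)"
proof -
  have "Max (x ` I) \<in> x ` I" using assms by (intro Max_in) auto
  then obtain k where k: "k \<in> I" "Max (x ` I) = x k" by blast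
  have le: "x i \<le> x k" if "i \<in> I" for i
    using Max_ge[of "x ` I" "x i"] assms that k by auto
  have pos: "(\<Sum>i\<in>I. exp (x i)) > 0" "real (card I) > 0"
    using assms by (auto intro!: sum_pos simp: card_gt_0_iff)
  have "exp (x k) \<le> (\<Sum>i\<in>I. exp (x i))"
    using k assms by (intro member_le_sum) auto
  then show "Max (x ` I) \<le> lse I x"
    unfolding lse_def k(2) using pos by (simp add: ln_ge_iff)
  have "(\<Sum>i\<in>I. exp (x i)) \<le> card I * exp (x k)"
    using sum_bounded_above[of I "\<lambda>i. exp (x i)" "exp (x k)"] le by auto
  then have "ln (\<Sum>i\<in>I. exp (x i)) \<le> ln (card I * exp (x k))"
    using pos by (subst ln_le_cancel_iff) auto
  also have "\<dots> = ln (card I) + x k"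
    using pos by (subst ln_mult) auto
  finally show "lse I x \<le> Max (x ` I) + ln (card I)"
    unfolding lse_def k(2) by simp
qed

lemma abs_Max_le_sum:
  assumes "finite I" "I \<noteq> {}"
  shows "\<bar>Max (x ` I) :: real\<bar> \<le> (\<Sum>i\<in>I. \<bar>x i\<bar>)"
proof -
  have "Max (x ` I) \<in> x ` I" using assms by (intro Max_in) auto
  then obtain k where k: "k \<in> I" "Max (x ` I) = x k" by blast
  show ?thesis
    unfolding k(2) using k(1) assms by (intro member_le_sum[where f="\<lambda>i. \<bar>x i\<bar>"]) auto
qed

lemma abs_lse_le:
  assumes "finite I" "I \<noteq> {}"
  shows "\<bar>lse I x\<bar> \<le> ln (card I) + (\<Sum>i\<in>I. \<bar>x i\<bar>)"
proof -
  have "1 \<le> card I" using assms by (simp add: Suc_leI card_gt_0_iff)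
  then have "0 \<le> ln (real (card I))" by simp
  with lse_bounds[OF assms, of x] abs_Max_le_sum[OF assms, of x] show ?thesis by linarith
qed

lemma borel_measurable_lse [measurable (raw)]:
  assumes "\<And>i. i \<in> I \<Longrightarrow> X i \<in> borel_measurable M"
  shows "(\<lambda>\<omega>. lse I (\<lambda>i. X i \<omega>)) \<in> borel_measurable M"
  unfolding lse_def using assms
  by (intro borel_measurable_ln borel_measurable_sum measurable_compose[OF _ borel_measurable_exp])

lemma integrable_lse:
  assumes "prob_space M" "finite I" "I \<noteq> {}" and X: "\<And>i. i \<in> I \<Longrightarrow> integrable M (X i)"
  shows "integrable M (\<lambda>\<omega>. lse I (\<lambda>i. X i \<omega>))"
proof -
  interpret prob_space M by fact
  have "integrable M (\<lambda>\<omega>. ln (card I) + (\<Sum>i\<in>I. \<bar>X i \<omega>\<bar>))"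
    using X by auto
  moreover have "(\<lambda>\<omega>. lse I (\<lambda>i. X i \<omega>)) \<in> borel_measurable M"
    using X by (auto intro!: borel_measurable_lse)
  ultimately show ?thesis
    using abs_lse_le[OF assms(2,3)] by (rule_tac Bochner_Integration.integrable_bound)
      (auto intro!: AE_I2 order_trans[OF _ abs_ge_self])
qed

text \<open>This makes expected softmax values a function of the joint law, hence of the
  characteristic functions. It is what allows a process to be replaced by a sum of independent
  pieces on another space.\<close>

lemma integral_lse_eqI_iexp:
  fixes X :: "'i \<Rightarrow> 'a \<Rightarrow> real" and Y :: "'i \<Rightarrow> 'b \<Rightarrow> real"
  assumes "prob_space M" "prob_space N" "finite I"
    and X: "\<And>i. i \<in> I \<Longrightarrow> X i \<in> borel_measurable M" and Y: "\<And>i. i \<in> I \<Longrightarrow> Y i \<in> borel_measurable N"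
    and eq: "\<And>c. (\<integral>\<omega>. iexp (\<Sum>i\<in>I. c i * X i \<omega>) \<partial>M) = (\<integral>\<omega>. iexp (\<Sum>i\<in>I. c i * Y i \<omega>) \<partial>N)"
  shows "(\<integral>\<omega>. lse I (\<lambda>i. m i + X i \<omega>) \<partial>M) = (\<integral>\<omega>. lse I (\<lambda>i. m i + Y i \<omega>) \<partial>N)"
proof -
  have [measurable]: "(\<lambda>\<omega>. \<lambda>i\<in>I. X i \<omega>) \<in> measurable M (PiM I (\<lambda>_. borel))"
    "(\<lambda>\<omega>. \<lambda>i\<in>I. Y i \<omega>) \<in> measurable N (PiM I (\<lambda>_. borel))"
    using X Y by (auto intro!: measurable_restrict)
  have [measurable]: "(\<lambda>x. lse I (\<lambda>i. m i + x i)) \<in> borel_measurable (PiM I (\<lambda>_. borel))"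
    by (intro borel_measurable_lse borel_measurable_add borel_measurable_const measurable_component_singleton)
  have r: "lse I (\<lambda>i. m i + (\<lambda>i\<in>I. z i) i) = lse I (\<lambda>i. m i + z i)" for z
    unfolding lse_def by (auto intro!: arg_cong[of _ _ ln] sum.cong)
  show ?thesis
    using distr_PiM_eqI_iexp[OF assms]
      integral_distr[of "\<lambda>\<omega>. \<lambda>i\<in>I. X i \<omega>" M "PiM I (\<lambda>_. borel)" "\<lambda>x. lse I (\<lambda>i. m i + x i)"]
      integral_distr[of "\<lambda>\<omega>. \<lambda>i\<in>I. Y i \<omega>" N "PiM I (\<lambda>_. borel)" "\<lambda>x. lse I (\<lambda>i. m i + x i)"]
    by (simp add: r del: restrict_apply)
qed

text \<open>The pointwise expansion is integrated around a deterministic base point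
  \<open>w\<close>: the linear term vanishes because the means are zero, and the quadratic term
  becomes a nonnegative combination of expected squared increments.\<close>

lemma integral_lse_expansion:
  fixes X :: "'i \<Rightarrow> 'a \<Rightarrow> real" and w :: "'i \<Rightarrow> real"
  assumes "prob_space M" and I: "finite I" "I \<noteq> {}" and "0 \<le> \<gamma>"
    and X: "\<And>i. i \<in> I \<Longrightarrow> integrable M (X i)" "\<And>i. i \<in> I \<Longrightarrow> (\<integral>\<omega>. X i \<omega> \<partial>M) = 0"
    and X2: "\<And>i j. i \<in> I \<Longrightarrow> j \<in> I \<Longrightarrow> integrable M (\<lambda>\<omega>. (X i \<omega> - X j \<omega>)\<^sup>2)"
    and X3: "\<And>i. i \<in> I \<Longrightarrow> integrable M (\<lambda>\<omega>. \<bar>X i \<omega>\<bar> ^ 3)"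
  defines "p \<equiv> \<lambda>i. exp (w i) / (\<Sum>j\<in>I. exp (w j))"
  shows "\<bar>(\<integral>\<omega>. lse I (\<lambda>i. w i + \<gamma> * X i \<omega>) \<partial>M) - lse I w
      - \<gamma>\<^sup>2 / 4 * (\<Sum>i\<in>I. \<Sum>j\<in>I. p i * p j * (\<integral>\<omega>. (X i \<omega> - X j \<omega>)\<^sup>2 \<partial>M))\<bar>
    \<le> \<gamma>^3 * (\<Sum>i\<in>I. \<integral>\<omega>. \<bar>X i \<omega>\<bar> ^ 3 \<partial>M)"
proof -
  interpret prob_space M by fact
  define L where "L \<omega> = lse I (\<lambda>i. w i + \<gamma> * X i \<omega>)" for \<omega>
  define A where "A \<omega> = (\<Sum>i\<in>I. p i * (\<gamma> * X i \<omega>))" for \<omega>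
  define Q where "Q \<omega> = (\<Sum>i\<in>I. \<Sum>j\<in>I. p i * p j * (X i \<omega> - X j \<omega>)\<^sup>2)" for \<omega>
  have iL: "integrable M L"
    unfolding L_def using X by (intro integrable_lse I assms(1)) auto
  have iA: "integrable M A" unfolding A_def using X by auto
  have iQ: "integrable M Q" unfolding Q_def using X2 by auto
  have EA: "(\<integral>\<omega>. A \<omega> \<partial>M) = 0"
    unfolding A_def using X by (subst Bochner_Integration.integral_sum) auto
  have EQ: "(\<integral>\<omega>. Q \<omega> \<partial>M) = (\<Sum>i\<in>I. \<Sum>j\<in>I. p i * p j * (\<integral>\<omega>. (X i \<omega> - X j \<omega>)\<^sup>2 \<partial>M))"
    unfolding Q_def using X2 by (subst Bochner_Integration.integral_sum; simp)
  have sq: "(\<gamma> * x - \<gamma> * y)\<^sup>2 = \<gamma>\<^sup>2 * (x - y)\<^sup>2" for x y :: real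
    by (simp add: right_diff_distrib[symmetric] power_mult_distrib)
  have "\<bar>L \<omega> - lse I w - A \<omega> - \<gamma>\<^sup>2 / 4 * Q \<omega>\<bar> \<le> (\<Sum>i\<in>I. \<gamma>^3 * \<bar>X i \<omega>\<bar>^3)" for \<omega>
  proof -
    have pw: "exp (w i) / (\<Sum>j\<in>I. exp (w j)) = p i" for i by (simp add: p_def)
    have "(\<Sum>i\<in>I. \<Sum>j\<in>I. p i * p j * (\<gamma> * X i \<omega> - \<gamma> * X j \<omega>)\<^sup>2) / 4 = \<gamma>\<^sup>2 / 4 * Q \<omega>"
      unfolding sq Q_def by (simp add: sum_distrib_left sum_divide_distrib mult_ac)
    moreover have "(\<Sum>i\<in>I. \<bar>\<gamma> * X i \<omega>\<bar>^3) = (\<Sum>i\<in>I. \<gamma>^3 * \<bar>X i \<omega>\<bar>^3)"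
      using \<open>0 \<le> \<gamma>\<close> by (simp add: abs_mult power_mult_distrib)
    moreover have "L \<omega> = ln (\<Sum>i\<in>I. exp (w i) * exp (\<gamma> * X i \<omega>))" "lse I w = ln (\<Sum>i\<in>I. exp (w i))"
      by (simp_all add: L_def lse_def exp_add)
    ultimately show ?thesis
      using ln_sum_exp_taylor[OF I, of "\<lambda>i. exp (w i)" "\<lambda>i. \<gamma> * X i \<omega>"]
      unfolding pw A_def by simp
  qed
  then have "(\<integral>\<omega>. \<bar>L \<omega> - lse I w - A \<omega> - \<gamma>\<^sup>2 / 4 * Q \<omega>\<bar> \<partial>M) \<le> (\<integral>\<omega>. (\<Sum>i\<in>I. \<gamma>^3 * \<bar>X i \<omega>\<bar>^3) \<partial>M)"
    using iL iA iQ X3 by (intro integral_mono) auto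
  then have "\<bar>\<integral>\<omega>. L \<omega> - lse I w - A \<omega> - \<gamma>\<^sup>2 / 4 * Q \<omega> \<partial>M\<bar> \<le> (\<integral>\<omega>. (\<Sum>i\<in>I. \<gamma>^3 * \<bar>X i \<omega>\<bar>^3) \<partial>M)"
    using integral_abs_bound[of M "\<lambda>\<omega>. L \<omega> - lse I w - A \<omega> - \<gamma>\<^sup>2 / 4 * Q \<omega>"] by linarith
  also have "(\<integral>\<omega>. L \<omega> - lse I w - A \<omega> - \<gamma>\<^sup>2 / 4 * Q \<omega> \<partial>M) = (\<integral>\<omega>. L \<omega> \<partial>M) - lse I w - \<gamma>\<^sup>2 / 4 * (\<integral>\<omega>. Q \<omega> \<partial>M)"
    using iL iA iQ EA by (simp add: prob_space)
  also have "(\<integral>\<omega>. (\<Sum>i\<in>I. \<gamma>^3 * \<bar>X i \<omega>\<bar>^3) \<partial>M) = \<gamma>^3 * (\<Sum>i\<in>I. \<integral>\<omega>. \<bar>X i \<omega>\<bar> ^ 3 \<partial>M)"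
    using X3 by (subst Bochner_Integration.integral_sum) (auto simp: sum_distrib_left)
  finally show ?thesis unfolding EQ L_def .
qed

lemma integral_pair_mult:
  fixes f :: "'a \<Rightarrow> complex" and g :: "'b \<Rightarrow> complex"
  assumes "prob_space P" "prob_space Q" and [measurable]: "f \<in> borel_measurable P" "g \<in> borel_measurable Q"
    and b: "\<And>x. norm (f x) \<le> 1" "\<And>x. norm (g x) \<le> 1"
  shows "(\<integral>x. f (fst x) * g (snd x) \<partial>(P \<Otimes>\<^sub>M Q)) = (\<integral>x. f x \<partial>P) * (\<integral>x. g x \<partial>Q)"
proof -
  interpret P: prob_space P by fact
  interpret Q: prob_space Q by fact
  interpret PQ: pair_prob_space P Q ..
  have "integrable (P \<Otimes>\<^sub>M Q) (\<lambda>x. f (fst x) * g (snd x))"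
    by (intro PQ.P.integrable_const_bound[of _ 1]) (auto simp: norm_mult intro!: mult_le_one b)
  from PQ.integral_fst'[OF this] show ?thesis by simp
qed

section \<open>Comparison of softmax expectations\<close>

lemma mean_zero_gaussian_processD:
  "mean_zero_gaussian_process M I X \<Longrightarrow> finite J \<Longrightarrow> J \<subseteq> I \<Longrightarrow> centered_gaussian M (\<lambda>\<omega>. \<Sum>j\<in>J. c j * X j \<omega>)"
  unfolding mean_zero_gaussian_process_def by blast

lemma mean_zero_gaussian_process_moments:
  assumes M: "prob_space M" and X: "mean_zero_gaussian_process M I X" and i: "i \<in> I"
  shows "integrable M (X i)" "(\<integral>\<omega>. X i \<omega> \<partial>M) = 0" "integrable M (\<lambda>\<omega>. \<bar>X i \<omega>\<bar> ^ 3)"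
    and "j \<in> I \<Longrightarrow> integrable M (\<lambda>\<omega>. (X i \<omega> - X j \<omega>)\<^sup>2)"
proof -
  have "centered_gaussian M (\<lambda>\<omega>. \<Sum>j\<in>{i}. 1 * X j \<omega>)"
    using mean_zero_gaussian_processD[OF X, of "{i}" "\<lambda>_. 1"] i by blast
  then have "centered_gaussian M (X i)" by simp
  from centered_gaussian_moments[OF M this]
  show "integrable M (X i)" "(\<integral>\<omega>. X i \<omega> \<partial>M) = 0" "integrable M (\<lambda>\<omega>. \<bar>X i \<omega>\<bar> ^ 3)"
    by auto
  show "integrable M (\<lambda>\<omega>. (X i \<omega> - X j \<omega>)\<^sup>2)" if j: "j \<in> I"
  \<comment> \<open>For i = j the set {i, j} is a singleton and the sum below would be
    \<open>X i\<close> instead of 0.\<close>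
  proof (cases "i = j")
    case False
    define c where "c l = (if l = i then 1 else - 1 :: real)" for l
    have "centered_gaussian M (\<lambda>\<omega>. \<Sum>l\<in>{i, j}. c l * X l \<omega>)"
      using i j by (intro mean_zero_gaussian_processD[OF X]) auto
    with False have "centered_gaussian M (\<lambda>\<omega>. X i \<omega> - X j \<omega>)"
      by (simp add: c_def)
    from centered_gaussian_moments(2)[OF M this] show ?thesis .
  qed simp
qed

text \<open>The square of \<alpha> is kept apart from the variance because products of such
  characteristic functions, and hence independent sums, then add the squares.\<close>

lemma mean_zero_gaussian_process_iexp:
  assumes M: "prob_space M" and X: "mean_zero_gaussian_process M I X" and I: "finite I"
  shows "(\<integral>\<omega>. iexp (\<Sum>i\<in>I. c i * (\<alpha> * X i \<omega>)) \<partial>M)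
    = complex_of_real (exp (- \<alpha>\<^sup>2 * (\<integral>\<omega>. (\<Sum>i\<in>I. c i * X i \<omega>)\<^sup>2 \<partial>M) / 2))"
proof -
  have eq: "(\<Sum>i\<in>I. (c i * \<alpha>) * X i \<omega>) = \<alpha> * (\<Sum>i\<in>I. c i * X i \<omega>)" for \<omega>
    by (simp add: sum_distrib_left mult_ac)
  have "centered_gaussian M (\<lambda>\<omega>. \<Sum>i\<in>I. (c i * \<alpha>) * X i \<omega>)"
    using mean_zero_gaussian_processD[OF X I order_refl] .
  from centered_gaussian_moments(5)[OF M this] show ?thesis
    unfolding eq power_mult_distrib by (simp add: sum_distrib_left mult.left_commute)
qed

lemma integral_iexp_pair:
  fixes A :: "'i \<Rightarrow> 'a \<Rightarrow> real" and B :: "'i \<Rightarrow> 'b \<Rightarrow> real"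
  assumes "prob_space P" "prob_space Q"
    and A: "\<And>i. i \<in> I \<Longrightarrow> A i \<in> borel_measurable P" and B: "\<And>i. i \<in> I \<Longrightarrow> B i \<in> borel_measurable Q"
  shows "(\<integral>z. iexp (\<Sum>i\<in>I. c i * (A i (fst z) + B i (snd z))) \<partial>(P \<Otimes>\<^sub>M Q))
    = (\<integral>x. iexp (\<Sum>i\<in>I. c i * A i x) \<partial>P) * (\<integral>y. iexp (\<Sum>i\<in>I. c i * B i y) \<partial>Q)"
proof -
  have e: "iexp (\<Sum>i\<in>I. c i * (A i x + B i y)) = iexp (\<Sum>i\<in>I. c i * A i x) * iexp (\<Sum>i\<in>I. c i * B i y)" for x y
    by (simp add: exp_add[symmetric] sum.distrib distrib_left)
  have [measurable]: "(\<lambda>x. \<Sum>i\<in>I. c i * A i x) \<in> borel_measurable P" "(\<lambda>y. \<Sum>i\<in>I. c i * B i y) \<in> borel_measurable Q"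
    using A B by (auto intro!: borel_measurable_sum borel_measurable_times)
  show ?thesis
    unfolding e by (intro integral_pair_mult assms) (auto simp del: of_real_sum)
qed

lemma integrable_pair_fst_snd:
  fixes f :: "'a \<Rightarrow> real" and g :: "'b \<Rightarrow> real"
  assumes "prob_space P" "prob_space Q"
  shows "integrable P f \<Longrightarrow> integrable (P \<Otimes>\<^sub>M Q) (\<lambda>z. f (fst z))"
    and "integrable Q g \<Longrightarrow> integrable (P \<Otimes>\<^sub>M Q) (\<lambda>z. g (snd z))"
proof -
  interpret P: prob_space P by fact
  interpret Q: prob_space Q by fact
  interpret PQ: pair_prob_space P Q ..
  show "integrable (P \<Otimes>\<^sub>M Q) (\<lambda>z. f (fst z))" if f: "integrable P f"
    using integrable_distr_eq[of fst "P \<Otimes>\<^sub>M Q" P f] f by (simp add: Q.distr_pair_fst)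
  assume g: "integrable Q g"
  then have "integrable (Q \<Otimes>\<^sub>M P) (\<lambda>z. g (fst z))"
    using integrable_distr_eq[of fst "Q \<Otimes>\<^sub>M P" Q g] by (simp add: P.distr_pair_fst)
  then show "integrable (P \<Otimes>\<^sub>M Q) (\<lambda>z. g (snd z))"
    using PQ.integrable_product_swap_iff[of "\<lambda>z. g (snd z)"] by (simp add: split_beta')
qed

text \<open>A single Lindeberg replacement. By Fubini the first coordinate is frozen, so that
  \<open>m\<close> and \<open>A\<close> form the base point of both expansions. Their second-order
  terms compare because the softmax weights are nonnegative, and the third-order error does not
  depend on the base point, so it survives integration.\<close>

lemma integral_lse_pair_le:
  fixes A :: "'i \<Rightarrow> 'c \<Rightarrow> real" and X :: "'i \<Rightarrow> 'a \<Rightarrow> real" and Y :: "'i \<Rightarrow> 'b \<Rightarrow> real"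
  assumes P: "prob_space P" and M: "prob_space M" and N: "prob_space N" and I: "finite I" "I \<noteq> {}" and "0 \<le> \<gamma>"
    and A: "\<And>i. i \<in> I \<Longrightarrow> integrable P (A i)"
    and X: "mean_zero_gaussian_process M I X" and Y: "mean_zero_gaussian_process N I Y"
    and inc: "\<And>i j. i \<in> I \<Longrightarrow> j \<in> I \<Longrightarrow> (\<integral>\<omega>. (X i \<omega> - X j \<omega>)\<^sup>2 \<partial>M) \<le> (\<integral>\<omega>. (Y i \<omega> - Y j \<omega>)\<^sup>2 \<partial>N)"
  shows "(\<integral>z. lse I (\<lambda>i. m i + (A i (fst z) + \<gamma> * X i (snd z))) \<partial>(P \<Otimes>\<^sub>M M))
    \<le> (\<integral>z. lse I (\<lambda>i. m i + (A i (fst z) + \<gamma> * Y i (snd z))) \<partial>(P \<Otimes>\<^sub>M N))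
      + \<gamma>^3 * ((\<Sum>i\<in>I. \<integral>\<omega>. \<bar>X i \<omega>\<bar> ^ 3 \<partial>M) + (\<Sum>i\<in>I. \<integral>\<omega>. \<bar>Y i \<omega>\<bar> ^ 3 \<partial>N))"
proof -
  interpret P: prob_space P by fact
  interpret M: prob_space M by fact
  interpret N: prob_space N by fact
  interpret PM: pair_prob_space P M ..
  interpret PN: pair_prob_space P N ..
  note mX = mean_zero_gaussian_process_moments[OF M X] and mY = mean_zero_gaussian_process_moments[OF N Y]
  note fst_snd_M = integrable_pair_fst_snd[OF P M] and fst_snd_N = integrable_pair_fst_snd[OF P N]
  have iX: "integrable (P \<Otimes>\<^sub>M M) (\<lambda>z. lse I (\<lambda>i. m i + (A i (fst z) + \<gamma> * X i (snd z))))"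
    by (intro integrable_lse I PM.prob_space_axioms Bochner_Integration.integrable_add
      integrable_mult_right PM.P.integrable_const fst_snd_M A mX)
  have iY: "integrable (P \<Otimes>\<^sub>M N) (\<lambda>z. lse I (\<lambda>i. m i + (A i (fst z) + \<gamma> * Y i (snd z))))"
    by (intro integrable_lse I PN.prob_space_axioms Bochner_Integration.integrable_add
      integrable_mult_right PN.P.integrable_const fst_snd_N A mY)
  define C where "C = (\<Sum>i\<in>I. \<integral>\<omega>. \<bar>X i \<omega>\<bar> ^ 3 \<partial>M) + (\<Sum>i\<in>I. \<integral>\<omega>. \<bar>Y i \<omega>\<bar> ^ 3 \<partial>N)"
  have le: "(\<integral>\<omega>. lse I (\<lambda>i. w i + \<gamma> * X i \<omega>) \<partial>M) \<le> (\<integral>\<omega>. lse I (\<lambda>i. w i + \<gamma> * Y i \<omega>) \<partial>N) + \<gamma>^3 * C" for w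
  proof -
    define p where "p i = exp (w i) / (\<Sum>j\<in>I. exp (w j))" for i
    have "0 \<le> p i" for i unfolding p_def by (intro divide_nonneg_nonneg sum_nonneg) auto
    then have "(\<Sum>i\<in>I. \<Sum>j\<in>I. p i * p j * (\<integral>\<omega>. (X i \<omega> - X j \<omega>)\<^sup>2 \<partial>M))
        \<le> (\<Sum>i\<in>I. \<Sum>j\<in>I. p i * p j * (\<integral>\<omega>. (Y i \<omega> - Y j \<omega>)\<^sup>2 \<partial>N))"
      by (intro sum_mono mult_left_mono inc mult_nonneg_nonneg)
    then have "\<gamma>\<^sup>2 / 4 * (\<Sum>i\<in>I. \<Sum>j\<in>I. p i * p j * (\<integral>\<omega>. (X i \<omega> - X j \<omega>)\<^sup>2 \<partial>M))
        \<le> \<gamma>\<^sup>2 / 4 * (\<Sum>i\<in>I. \<Sum>j\<in>I. p i * p j * (\<integral>\<omega>. (Y i \<omega> - Y j \<omega>)\<^sup>2 \<partial>N))"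
      by (intro mult_left_mono) auto
    moreover have "\<bar>(\<integral>\<omega>. lse I (\<lambda>i. w i + \<gamma> * X i \<omega>) \<partial>M) - lse I w
        - \<gamma>\<^sup>2 / 4 * (\<Sum>i\<in>I. \<Sum>j\<in>I. p i * p j * (\<integral>\<omega>. (X i \<omega> - X j \<omega>)\<^sup>2 \<partial>M))\<bar>
        \<le> \<gamma>^3 * (\<Sum>i\<in>I. \<integral>\<omega>. \<bar>X i \<omega>\<bar> ^ 3 \<partial>M)"
      unfolding p_def by (rule integral_lse_expansion[OF M I \<open>0 \<le> \<gamma>\<close> mX(1,2,4,3)])
    moreover have "\<bar>(\<integral>\<omega>. lse I (\<lambda>i. w i + \<gamma> * Y i \<omega>) \<partial>N) - lse I w
        - \<gamma>\<^sup>2 / 4 * (\<Sum>i\<in>I. \<Sum>j\<in>I. p i * p j * (\<integral>\<omega>. (Y i \<omega> - Y j \<omega>)\<^sup>2 \<partial>N))\<bar>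
        \<le> \<gamma>^3 * (\<Sum>i\<in>I. \<integral>\<omega>. \<bar>Y i \<omega>\<bar> ^ 3 \<partial>N)"
      unfolding p_def by (rule integral_lse_expansion[OF N I \<open>0 \<le> \<gamma>\<close> mY(1,2,4,3)])
    ultimately show ?thesis
      unfolding C_def distrib_left by linarith
  qed
  have "(\<integral>z. lse I (\<lambda>i. m i + (A i (fst z) + \<gamma> * X i (snd z))) \<partial>(P \<Otimes>\<^sub>M M))
      = (\<integral>x. \<integral>y. lse I (\<lambda>i. (m i + A i x) + \<gamma> * X i y) \<partial>M \<partial>P)"
    using PM.integral_fst'[OF iX] by (simp add: add.assoc)
  also have "\<dots> \<le> (\<integral>x. (\<integral>y. lse I (\<lambda>i. (m i + A i x) + \<gamma> * Y i y) \<partial>N) + \<gamma>^3 * C \<partial>P)"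
    using PM.integrable_fst'[OF iX] PN.integrable_fst'[OF iY]
    by (intro integral_mono le) (simp_all add: add.assoc)
  also have "\<dots> = (\<integral>x. \<integral>y. lse I (\<lambda>i. (m i + A i x) + \<gamma> * Y i y) \<partial>N \<partial>P) + \<gamma>^3 * C"
    using PN.integrable_fst'[OF iY] by (simp add: add.assoc P.prob_space)
  also have "(\<integral>x. \<integral>y. lse I (\<lambda>i. (m i + A i x) + \<gamma> * Y i y) \<partial>N \<partial>P)
      = (\<integral>z. lse I (\<lambda>i. m i + (A i (fst z) + \<gamma> * Y i (snd z))) \<partial>(P \<Otimes>\<^sub>M N))"
    using PN.integral_fst'[OF iY] by (simp add: add.assoc)
  finally show ?thesis unfolding C_def .
qed

text \<open>With \<open>X\<close> and \<open>Y\<close> made independent on the product space, the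
  pair of coefficients moves along the quarter circle from (1, 0) to (0, 1). The n replacement
  errors sum to \<open>C * sqrt (1 / n)\<close>, which tends to 0.\<close>

lemma integral_lse_mono:
  fixes X :: "'i \<Rightarrow> 'a \<Rightarrow> real" and Y :: "'i \<Rightarrow> 'b \<Rightarrow> real"
  assumes M: "prob_space M" and N: "prob_space N" and I: "finite I" "I \<noteq> {}"
    and X: "mean_zero_gaussian_process M I X" and Y: "mean_zero_gaussian_process N I Y"
    and inc: "\<And>i j. i \<in> I \<Longrightarrow> j \<in> I \<Longrightarrow> (\<integral>\<omega>. (X i \<omega> - X j \<omega>)\<^sup>2 \<partial>M) \<le> (\<integral>\<omega>. (Y i \<omega> - Y j \<omega>)\<^sup>2 \<partial>N)"
  shows "(\<integral>\<omega>. lse I (\<lambda>i. m i + X i \<omega>) \<partial>M) \<le> (\<integral>\<omega>. lse I (\<lambda>i. m i + Y i \<omega>) \<partial>N)"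
proof -
  interpret M: prob_space M by fact
  interpret N: prob_space N by fact
  interpret MN: pair_prob_space M N ..
  note MN = MN.prob_space_axioms
  define C where "C = (\<Sum>i\<in>I. \<integral>\<omega>. \<bar>X i \<omega>\<bar> ^ 3 \<partial>M) + (\<Sum>i\<in>I. \<integral>\<omega>. \<bar>Y i \<omega>\<bar> ^ 3 \<partial>N)"
  define u where "u c = (\<integral>\<omega>. (\<Sum>i\<in>I. c i * X i \<omega>)\<^sup>2 \<partial>M)" for c
  define v where "v c = (\<integral>\<omega>. (\<Sum>i\<in>I. c i * Y i \<omega>)\<^sup>2 \<partial>N)" for c
  note mX = mean_zero_gaussian_process_moments[OF M X] and mY = mean_zero_gaussian_process_moments[OF N Y]
  have [measurable]: "X i \<in> borel_measurable M" "Y i \<in> borel_measurable N" if "i \<in> I" for i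
    using mX(1)[OF that] mY(1)[OF that] by auto
  define W where "W \<alpha> \<beta> i z = \<alpha> * X i (fst z) + \<beta> * Y i (snd z)" for \<alpha> \<beta> i z
  have W: "integrable (M \<Otimes>\<^sub>M N) (W \<alpha> \<beta> i)" if "i \<in> I" for \<alpha> \<beta> i
    unfolding W_def using that
    by (intro Bochner_Integration.integrable_add integrable_mult_right integrable_pair_fst_snd M N mX mY)
  then have mW: "W \<alpha> \<beta> i \<in> borel_measurable (M \<Otimes>\<^sub>M N)" if "i \<in> I" for \<alpha> \<beta> i
    using that by blast
  have cfX: "(\<integral>\<omega>. iexp (\<Sum>i\<in>I. c i * (\<alpha> * X i \<omega>)) \<partial>M) = complex_of_real (exp (- \<alpha>\<^sup>2 * u c / 2))" for \<alpha> c
    unfolding u_def by (rule mean_zero_gaussian_process_iexp[OF M X I(1)])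
  have cfY: "(\<integral>\<omega>. iexp (\<Sum>i\<in>I. c i * (\<alpha> * Y i \<omega>)) \<partial>N) = complex_of_real (exp (- \<alpha>\<^sup>2 * v c / 2))" for \<alpha> c
    unfolding v_def by (rule mean_zero_gaussian_process_iexp[OF N Y I(1)])
  \<comment> \<open>The coefficients enter only through their squares. An extra independent
    \<open>\<gamma> * X i\<close> therefore has the same effect on the law as enlarging the square
    of \<alpha> by that of \<gamma>, and likewise for \<open>Y\<close> and \<beta>.\<close>
  have cfW: "(\<integral>z. iexp (\<Sum>i\<in>I. c i * W \<alpha> \<beta> i z) \<partial>(M \<Otimes>\<^sub>M N))
      = complex_of_real (exp (- (\<alpha>\<^sup>2 * u c + \<beta>\<^sup>2 * v c) / 2))" for \<alpha> \<beta> c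
    unfolding W_def
    by (subst integral_iexp_pair[OF M N])
      (auto simp only: cfX cfY of_real_mult[symmetric] exp_add[symmetric] intro!: arg_cong[of _ _ complex_of_real] arg_cong[of _ _ exp],
       auto simp: field_simps)
  have cfWX: "(\<integral>z. iexp (\<Sum>i\<in>I. c i * (W \<alpha> \<beta> i (fst z) + \<gamma> * X i (snd z))) \<partial>((M \<Otimes>\<^sub>M N) \<Otimes>\<^sub>M M))
      = complex_of_real (exp (- ((\<alpha>\<^sup>2 + \<gamma>\<^sup>2) * u c + \<beta>\<^sup>2 * v c) / 2))" for \<alpha> \<beta> \<gamma> c
    by (subst integral_iexp_pair[OF MN M])
      (auto simp only: cfW cfX of_real_mult[symmetric] exp_add[symmetric] intro!: arg_cong[of _ _ complex_of_real] arg_cong[of _ _ exp] mW,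
       auto simp: field_simps)
  have cfWY: "(\<integral>z. iexp (\<Sum>i\<in>I. c i * (W \<alpha> \<beta> i (fst z) + \<gamma> * Y i (snd z))) \<partial>((M \<Otimes>\<^sub>M N) \<Otimes>\<^sub>M N))
      = complex_of_real (exp (- (\<alpha>\<^sup>2 * u c + (\<beta>\<^sup>2 + \<gamma>\<^sup>2) * v c) / 2))" for \<alpha> \<beta> \<gamma> c
    by (subst integral_iexp_pair[OF MN N])
      (auto simp only: cfW cfY of_real_mult[symmetric] exp_add[symmetric] intro!: arg_cong[of _ _ complex_of_real] arg_cong[of _ _ exp] mW,
       auto simp: field_simps)
  define \<phi> where "\<phi> \<alpha> \<beta> = (\<integral>z. lse I (\<lambda>i. m i + W \<alpha> \<beta> i z) \<partial>(M \<Otimes>\<^sub>M N))" for \<alpha> \<beta>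
  interpret MNM: pair_prob_space "M \<Otimes>\<^sub>M N" M ..
  interpret MNN: pair_prob_space "M \<Otimes>\<^sub>M N" N ..
  have step: "\<phi> \<alpha>' \<beta> \<le> \<phi> \<alpha> \<beta>' + \<gamma>^3 * C"
    if "\<alpha>'\<^sup>2 = \<alpha>\<^sup>2 + \<gamma>\<^sup>2" "\<beta>'\<^sup>2 = \<beta>\<^sup>2 + \<gamma>\<^sup>2" "0 \<le> \<gamma>" for \<alpha> \<beta> \<gamma> \<alpha>' \<beta>'
  proof -
    have "\<phi> \<alpha>' \<beta> = (\<integral>z. lse I (\<lambda>i. m i + (W \<alpha> \<beta> i (fst z) + \<gamma> * X i (snd z))) \<partial>((M \<Otimes>\<^sub>M N) \<Otimes>\<^sub>M M))"
      unfolding \<phi>_def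
      by (rule integral_lse_eqI_iexp[OF MN MNM.prob_space_axioms I(1)], unfold cfW cfWX that)
        (auto intro!: mW borel_measurable_add borel_measurable_times measurable_compose[OF measurable_fst mW]
          measurable_compose[OF measurable_snd])
    also have "\<dots> \<le> (\<integral>z. lse I (\<lambda>i. m i + (W \<alpha> \<beta> i (fst z) + \<gamma> * Y i (snd z))) \<partial>((M \<Otimes>\<^sub>M N) \<Otimes>\<^sub>M N)) + \<gamma>^3 * C"
      unfolding C_def by (rule integral_lse_pair_le[OF MN M N I that(3) W X Y inc])
    also have "(\<integral>z. lse I (\<lambda>i. m i + (W \<alpha> \<beta> i (fst z) + \<gamma> * Y i (snd z))) \<partial>((M \<Otimes>\<^sub>M N) \<Otimes>\<^sub>M N)) = \<phi> \<alpha> \<beta>'"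
      unfolding \<phi>_def
      by (rule integral_lse_eqI_iexp[OF MNN.prob_space_axioms MN I(1)], unfold cfW cfWY that)
        (auto intro!: mW borel_measurable_add borel_measurable_times measurable_compose[OF measurable_fst mW]
          measurable_compose[OF measurable_snd])
    finally show ?thesis .
  qed
  have "\<phi> 1 0 \<le> \<phi> 0 1 + C * sqrt (1 / n)" if n: "n > 0" for n :: nat
  proof -
    \<comment> \<open>After j replacements the squared coefficients are (n - j)/n and j/n. The bound
      j \<le> n keeps the first radicand nonnegative, so that squaring undoes the root.\<close>
    have "\<phi> (sqrt 1) (sqrt 0) \<le> \<phi> (sqrt ((real n - real j) / n)) (sqrt (j / n)) + j * (sqrt (1 / n) ^ 3 * C)"
      if "j \<le> n" for j
      using that
    proof (induction j)
      case 0
      with n show ?case by simp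
    next
      case (Suc j)
      have "\<phi> (sqrt ((real n - real j) / n)) (sqrt (j / n))
          \<le> \<phi> (sqrt ((real n - real (Suc j)) / n)) (sqrt (Suc j / n)) + sqrt (1 / n) ^ 3 * C"
      proof (rule step)
        have "0 \<le> (real n - real (Suc j)) / n" using Suc.prems by simp
        then show "(sqrt ((real n - real j) / n))\<^sup>2 = (sqrt ((real n - real (Suc j)) / n))\<^sup>2 + (sqrt (1 / n))\<^sup>2"
          using Suc.prems by (simp only: real_sqrt_pow2) (simp add: diff_divide_distrib add_divide_distrib)
      qed (auto simp: add_divide_distrib)
      with Suc show ?case by (simp add: distrib_right)
    qed
    from this[of n] n have "\<phi> 1 0 \<le> \<phi> 0 1 + n * (sqrt (1 / n) ^ 3 * C)" by simp
    also have "sqrt (1 / n) ^ 3 = sqrt (1 / n) * (1 / n)"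
      by (simp add: power3_eq_cube)
    finally show ?thesis using n by (simp add: mult.commute)
  qed
  then have "\<forall>\<^sub>F n in sequentially. \<phi> 1 0 \<le> \<phi> 0 1 + C * sqrt (1 / real n)"
    by (auto simp: eventually_sequentially intro: exI[of _ 1])
  moreover have "(\<lambda>n. \<phi> 0 1 + C * sqrt (1 / real n)) \<longlonglongrightarrow> \<phi> 0 1 + C * sqrt 0"
    by (intro tendsto_intros lim_1_over_n)
  ultimately have "\<phi> 1 0 \<le> \<phi> 0 1"
    using tendsto_lowerbound[of _ "\<phi> 0 1 + C * sqrt 0" sequentially "\<phi> 1 0"] by simp
  moreover have "\<phi> 1 0 = (\<integral>\<omega>. lse I (\<lambda>i. m i + X i \<omega>) \<partial>M)"
    unfolding \<phi>_def
    by (rule integral_lse_eqI_iexp[OF MN M I(1)], unfold cfW cfX[of _ 1, unfolded mult_1]) (auto intro!: mW)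
  moreover have "\<phi> 0 1 = (\<integral>\<omega>. lse I (\<lambda>i. m i + Y i \<omega>) \<partial>N)"
    unfolding \<phi>_def
    by (rule integral_lse_eqI_iexp[OF MN N I(1)], unfold cfW cfY[of _ 1, unfolded mult_1]) (auto intro!: mW)
  ultimately show ?thesis by simp
qed

section \<open>From the softmax to increasing convex functions of the maximum\<close>

lemma integrable_Max:
  assumes "finite I" "I \<noteq> {}" and X: "\<And>i. i \<in> I \<Longrightarrow> integrable M (X i :: 'a \<Rightarrow> real)"
  shows "integrable M (\<lambda>\<omega>. Max ((\<lambda>i. X i \<omega>) ` I))"
proof (rule Bochner_Integration.integrable_bound)
  show "integrable M (\<lambda>\<omega>. \<Sum>i\<in>I. \<bar>X i \<omega>\<bar>)" using X by auto
  show "(\<lambda>\<omega>. Max ((\<lambda>i. X i \<omega>) ` I)) \<in> borel_measurable M"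
    using X assms(1) by (auto intro!: borel_measurable_Max)
  show "AE \<omega> in M. norm (Max ((\<lambda>i. X i \<omega>) ` I)) \<le> norm (\<Sum>i\<in>I. \<bar>X i \<omega>\<bar>)"
    using abs_Max_le_sum[OF assms(1,2)] by (auto intro!: AE_I2 order_trans[OF _ abs_ge_self])
qed

lemma mean_zero_gaussian_process_scale:
  assumes "mean_zero_gaussian_process M I X"
  shows "mean_zero_gaussian_process M I (\<lambda>i \<omega>. b * X i \<omega>)"
  unfolding mean_zero_gaussian_process_def
proof safe
  fix J c assume "finite J" "J \<subseteq> I"
  from mean_zero_gaussian_processD[OF assms this, of "\<lambda>j. c j * b"]
  show "centered_gaussian M (\<lambda>\<omega>. \<Sum>j\<in>J. c j * (b * X j \<omega>))"
    by (simp add: mult.assoc)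
qed

lemma mean_zero_gaussian_process_subset:
  "mean_zero_gaussian_process M I X \<Longrightarrow> J \<subseteq> I \<Longrightarrow> mean_zero_gaussian_process M J X"
  unfolding mean_zero_gaussian_process_def by (meson subset_trans)

text \<open>The softmax exceeds the maximum by at most ln (card I), whatever the scale. Multiplying
  all data by n and dividing the comparison by n shrinks this gap to ln (card I) / n; both sides of
  the increment hypothesis merely gain the factor n squared.\<close>

lemma integral_Max_mono:
  fixes X :: "'i \<Rightarrow> 'a \<Rightarrow> real" and Y :: "'i \<Rightarrow> 'b \<Rightarrow> real"
  assumes M: "prob_space M" and N: "prob_space N" and I: "finite I" "I \<noteq> {}"
    and X: "mean_zero_gaussian_process M I X" and Y: "mean_zero_gaussian_process N I Y"
    and inc: "\<And>i j. i \<in> I \<Longrightarrow> j \<in> I \<Longrightarrow> (\<integral>\<omega>. (X i \<omega> - X j \<omega>)\<^sup>2 \<partial>M) \<le> (\<integral>\<omega>. (Y i \<omega> - Y j \<omega>)\<^sup>2 \<partial>N)"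
  shows "(\<integral>\<omega>. Max ((\<lambda>i. m i + X i \<omega>) ` I) \<partial>M) \<le> (\<integral>\<omega>. Max ((\<lambda>i. m i + Y i \<omega>) ` I) \<partial>N)"
proof -
  interpret M: prob_space M by fact
  interpret N: prob_space N by fact
  note mX = mean_zero_gaussian_process_moments[OF M X] and mY = mean_zero_gaussian_process_moments[OF N Y]
  define U where "U \<omega> = Max ((\<lambda>i. m i + X i \<omega>) ` I)" for \<omega>
  define V where "V \<omega> = Max ((\<lambda>i. m i + Y i \<omega>) ` I)" for \<omega>
  have iU: "integrable M U" and iV: "integrable N V"
    unfolding U_def V_def using mX(1) mY(1) by (auto intro!: integrable_Max I)
  have sq: "(b * x - b * y)\<^sup>2 = b\<^sup>2 * (x - y)\<^sup>2" for b x y :: real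
    by (simp add: right_diff_distrib[symmetric] power_mult_distrib)
  have scale: "b * Max (x ` I) = Max ((\<lambda>i. b * x i) ` I)" if "b > 0" for b :: real and x
    using that by (subst mono_Max_commute[of "\<lambda>y. b * y"]) (auto simp: mono_def I image_image)
  have "(\<integral>\<omega>. U \<omega> \<partial>M) \<le> (\<integral>\<omega>. V \<omega> \<partial>N) + ln (card I) * (1 / n)" if n: "n > 0" for n :: nat
  proof -
    have "n * U \<omega> \<le> lse I (\<lambda>i. n * m i + n * X i \<omega>)" for \<omega>
      using lse_bounds(1)[OF I] n unfolding U_def by (subst scale) (auto simp: distrib_left)
    then have "(\<integral>\<omega>. n * U \<omega> \<partial>M) \<le> (\<integral>\<omega>. lse I (\<lambda>i. n * m i + n * X i \<omega>) \<partial>M)"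
      using iU mX(1) by (intro integral_mono integrable_lse M I) auto
    also have "\<dots> \<le> (\<integral>\<omega>. lse I (\<lambda>i. n * m i + n * Y i \<omega>) \<partial>N)"
      using inc unfolding sq
      by (intro integral_lse_mono[OF M N I] mean_zero_gaussian_process_scale X Y) (auto simp: sq intro: mult_left_mono)
    also have "\<dots> \<le> (\<integral>\<omega>. n * V \<omega> + ln (card I) \<partial>N)"
    proof (intro integral_mono integrable_lse N I)
      show "lse I (\<lambda>i. n * m i + n * Y i \<omega>) \<le> n * V \<omega> + ln (card I)" for \<omega>
        using lse_bounds(2)[OF I] n unfolding V_def by (subst scale) (auto simp: distrib_left)
    qed (use iV mY(1) in auto)
    finally show ?thesis using iV n by (simp add: field_simps N.prob_space)
  qed
  then have "\<forall>\<^sub>F n in sequentially. (\<integral>\<omega>. U \<omega> \<partial>M) \<le> (\<integral>\<omega>. V \<omega> \<partial>N) + ln (card I) * (1 / real n)"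
    by (intro eventually_sequentiallyI[of 1]) auto
  moreover have "(\<lambda>n. (\<integral>\<omega>. V \<omega> \<partial>N) + ln (card I) * (1 / real n)) \<longlonglongrightarrow> (\<integral>\<omega>. V \<omega> \<partial>N) + ln (card I) * 0"
    by (intro tendsto_intros lim_1_over_n)
  ultimately show ?thesis
    using tendsto_lowerbound[of _ "(\<integral>\<omega>. V \<omega> \<partial>N) + ln (card I) * 0" sequentially "\<integral>\<omega>. U \<omega> \<partial>M"]
    by (simp add: U_def V_def)
qed

text \<open>After subtraction of \<open>X k\<close> the term of index k is the constant
  \<open>m k\<close>, so raising \<open>m k\<close> implements the truncation at \<open>t\<close>.
  The subtracted variable has mean zero and leaves a comparison of expected maxima.\<close>

lemma integral_max_Max_diff_mono:
  fixes X :: "'i \<Rightarrow> 'a \<Rightarrow> real" and Y :: "'i \<Rightarrow> 'b \<Rightarrow> real"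
  assumes M: "prob_space M" and N: "prob_space N" and I: "finite I" and k: "k \<in> I"
    and X: "mean_zero_gaussian_process M I X" and Y: "mean_zero_gaussian_process N I Y"
    and inc: "\<And>i j. i \<in> I \<Longrightarrow> j \<in> I \<Longrightarrow> (\<integral>\<omega>. (X i \<omega> - X j \<omega>)\<^sup>2 \<partial>M) \<le> (\<integral>\<omega>. (Y i \<omega> - Y j \<omega>)\<^sup>2 \<partial>N)"
  shows "(\<integral>\<omega>. max (Max ((\<lambda>i. m i + X i \<omega>) ` I) - X k \<omega>) t \<partial>M)
    \<le> (\<integral>\<omega>. max (Max ((\<lambda>i. m i + Y i \<omega>) ` I) - Y k \<omega>) t \<partial>N)"
proof -
  have I0: "I \<noteq> {}" using k by auto
  define m' where "m' = m(k := max (m k) t)"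
  have eq: "max (Max ((\<lambda>i. m i + x i) ` I) - x k) t = Max ((\<lambda>i. m' i + x i) ` I) - x k" for x :: "'i \<Rightarrow> real"
  proof -
    \<comment> \<open>The two maxima are identified by showing that they have the same upper bounds
      \<open>b\<close>.\<close>
    have "m' i + x i \<le> b \<longleftrightarrow> m i + x i \<le> b \<and> (i = k \<longrightarrow> t + x k \<le> b)" for b i
      unfolding m'_def by (cases "i = k"; simp; linarith)
    then have "Max ((\<lambda>i. m' i + x i) ` I) \<le> b \<longleftrightarrow> max (Max ((\<lambda>i. m i + x i) ` I)) (t + x k) \<le> b" for b
      using I I0 k by (simp only: Max_le_iff finite_imageI image_is_empty max.bounded_iff ball_simps simp_thms) blast
    then have "Max ((\<lambda>i. m' i + x i) ` I) = max (Max ((\<lambda>i. m i + x i) ` I)) (t + x k)"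
      by (intro order_antisym) blast+
    then show ?thesis by (simp add: max_def)
  qed
  note mX = mean_zero_gaussian_process_moments[OF M X] and mY = mean_zero_gaussian_process_moments[OF N Y]
  interpret M: prob_space M by fact
  interpret N: prob_space N by fact
  have "integrable M (\<lambda>\<omega>. Max ((\<lambda>i. m' i + X i \<omega>) ` I))" "integrable N (\<lambda>\<omega>. Max ((\<lambda>i. m' i + Y i \<omega>) ` I))"
    using mX(1) mY(1) by (auto intro!: integrable_Max I I0)
  then show ?thesis
    unfolding eq[where x = "\<lambda>i. X i \<omega>" for \<omega>] eq[where x = "\<lambda>i. Y i \<omega>" for \<omega>] using mX(1,2)[OF k] mY(1,2)[OF k] integral_Max_mono[OF M N I I0 X Y inc, of m'] by simp
qed

text \<open>Secant slopes of a convex function increase, so a secant prolonged to the right stays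
  below the graph. It takes the place of a tangent and avoids derivatives of
  \<open>h\<close>.\<close>

lemma convex_secant_le:
  fixes h :: "real \<Rightarrow> real"
  assumes h: "convex_on UNIV h" and "\<delta> > 0" "t \<le> x"
  shows "h t + (h t - h (t - \<delta>)) / \<delta> * (x - t) \<le> h x"
proof (cases "t = x")
  case False
  then have "t < x" using assms by simp
  have "(h (t - \<delta>) - h x) / (t - \<delta> - x) \<le> (h t - h x) / (t - x)"
    "(h (t - \<delta>) - h t) / (t - \<delta> - t) \<le> (h (t - \<delta>) - h x) / (t - \<delta> - x)"
    using convex_on_slope_le[OF h, of "t - \<delta>" x t] \<open>t < x\<close> \<open>\<delta> > 0\<close> by auto
  then have "(h (t - \<delta>) - h t) / (t - \<delta> - t) \<le> (h t - h x) / (t - x)" by linarith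
  moreover have "(h (t - \<delta>) - h t) / (t - \<delta> - t) = (h t - h (t - \<delta>)) / \<delta>"
    using \<open>\<delta> > 0\<close> by (simp add: field_simps)
  moreover have "(h t - h x) / (t - x) = (h x - h t) / (x - t)"
    using \<open>t < x\<close> by (simp add: field_simps)
  ultimately have "(h t - h (t - \<delta>)) / \<delta> \<le> (h x - h t) / (x - t)" by simp
  then show ?thesis using \<open>t < x\<close> by (simp add: pos_le_divide_eq)
qed simp

text \<open>The hinge sum is the piecewise linear interpolation of \<open>h (x - \<delta>)\<close> at the points \<open>a + j \<delta>\<close>.\<close>

lemma convex_mono_hinge_approx:
  fixes h :: "real \<Rightarrow> real" and a \<delta> :: real and n :: nat
  assumes h: "convex_on UNIV h" "mono h" and \<delta>: "\<delta> > 0"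
  obtains c :: "nat \<Rightarrow> real" where "\<And>j. 0 \<le> c j"
    and "\<And>x. a \<le> x \<Longrightarrow> h (a - \<delta>) + (\<Sum>j\<le>n. c j * max (x - (a + j * \<delta>)) 0) \<le> h x"
    and "\<And>x. a \<le> x \<Longrightarrow> x \<le> a + n * \<delta> \<Longrightarrow> h (x - 2 * \<delta>) \<le> h (a - \<delta>) + (\<Sum>j\<le>n. c j * max (x - (a + j * \<delta>)) 0)"
proof
  define t where "t j = a + real j * \<delta>" for j :: nat
  have tS: "t (Suc j) = t j + \<delta>" for j by (simp add: t_def distrib_right)
  define s where "s j = (h (t j) - h (t j - \<delta>)) / \<delta>" for j
  have s0: "0 \<le> s j" for j
    using \<delta> monoD[OF h(2), of "t j - \<delta>" "t j"] by (simp add: s_def)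
  \<comment> \<open>Hinge weights are slope increments, nonnegative by convexity. The first one
    carries the whole initial slope, nonnegative by monotonicity.\<close>
  define c where "c j = (case j of 0 \<Rightarrow> s 0 | Suc i \<Rightarrow> s (Suc i) - s i)" for j
  show "0 \<le> c j" for j
  proof (cases j)
    case (Suc i)
    have "h (t i) + s i * \<delta> \<le> h (t i + \<delta>)"
      using convex_secant_le[OF h(1) \<delta>, of "t i" "t i + \<delta>"] \<delta> by (simp add: s_def)
    then have "s i \<le> s (Suc i)"
      using \<delta> by (simp add: s_def tS pos_le_divide_eq)
    with Suc show ?thesis by (simp add: c_def)
  qed (simp add: c_def s0)
  \<comment> \<open>Without truncation the first hinges telescope to the line of slope
    \<open>s k\<close> through the value of \<open>h\<close> at \<open>t k - \<delta>\<close>.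
    Consecutive lines meet at the next node, because \<open>s k * \<delta>\<close> is the rise of
    \<open>h\<close> on the shifted cell.\<close>
  have P: "h (a - \<delta>) + (\<Sum>j\<le>k. c j * (x - t j)) = h (t k - \<delta>) + s k * (x - t k)" for k x
  proof (induction k)
    case 0
    show ?case by (simp add: c_def t_def)
  next
    case (Suc k)
    have "s k * \<delta> = h (t k) - h (t k - \<delta>)" using \<delta> by (simp add: s_def)
    with Suc show ?case by (simp add: c_def tS algebra_simps)
  qed
  \<comment> \<open>Exactly the hinges whose node lies to the left of \<open>x\<close> are active.
    The alternative k = n covers points beyond the last node, where the last line is simply
    prolonged.\<close>
  have act: "\<exists>k\<le>n. t k \<le> x \<and> (x \<le> t k + \<delta> \<or> k = n) \<and>
      h (a - \<delta>) + (\<Sum>j\<le>n. c j * max (x - t j) 0) = h (t k - \<delta>) + s k * (x - t k)" if "a \<le> x" for x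
  proof -
    define k where "k = min n (nat \<lfloor>(x - a) / \<delta>\<rfloor>)"
    define r where "r = nat \<lfloor>(x - a) / \<delta>\<rfloor>"
    have r0: "0 \<le> (x - a) / \<delta>" using that \<delta> by simp
    have r: "real r \<le> (x - a) / \<delta>" "(x - a) / \<delta> < real r + 1"
      unfolding r_def using r0 by linarith+
    then have r': "real r * \<delta> \<le> x - a" "x - a < (real r + 1) * \<delta>"
      using \<delta> by (simp_all add: pos_le_divide_eq pos_divide_less_eq)
    have tle: "t j \<le> x" if "j \<le> r" for j
    proof -
      have "real j * \<delta> \<le> real r * \<delta>" using that \<delta> by simp
      with r' show ?thesis by (simp add: t_def)
    qed
    have tge: "x \<le> t j" if "r < j" for j
    proof -
      have "(real r + 1) * \<delta> \<le> real j * \<delta>" using that \<delta> by (intro mult_right_mono) auto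
      with r' show ?thesis by (simp add: t_def)
    qed
    have kr: "k = min n r" by (simp add: k_def r_def)
    have "(\<Sum>j\<le>n. c j * max (x - t j) 0) = (\<Sum>j\<le>k. c j * (x - t j))"
    proof (rule sum.mono_neutral_cong_right)
      show "\<forall>j\<in>{..n} - {..k}. c j * max (x - t j) 0 = 0"
        using tge by (auto simp: kr max_def)
      show "c j * max (x - t j) 0 = c j * (x - t j)" if "j \<in> {..k}" for j
        using tle[of j] that by (auto simp: kr max_def)
    qed (auto simp: kr)
    moreover have "t k \<le> x" using tle[of k] by (simp add: kr)
    moreover have "x \<le> t k + \<delta> \<or> k = n"
      using r' by (auto simp: kr t_def algebra_simps min_def)
    ultimately show ?thesis using P[where k = k and x = x] by (intro exI[of _ k]) (simp add: kr)
  qed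
  show "h (a - \<delta>) + (\<Sum>j\<le>n. c j * max (x - (a + j * \<delta>)) 0) \<le> h x" if x: "a \<le> x" for x
  proof -
    obtain k where k: "t k \<le> x"
      "h (a - \<delta>) + (\<Sum>j\<le>n. c j * max (x - t j) 0) = h (t k - \<delta>) + s k * (x - t k)"
      using act[OF x] by auto
    have "h (t k - \<delta>) \<le> h (t k)" using \<delta> by (intro monoD[OF h(2)]) simp
    with k convex_secant_le[OF h(1) \<delta> k(1)] show ?thesis unfolding s_def t_def by linarith
  qed
  show "h (x - 2 * \<delta>) \<le> h (a - \<delta>) + (\<Sum>j\<le>n. c j * max (x - (a + j * \<delta>)) 0)"
    if x: "a \<le> x" "x \<le> a + n * \<delta>" for x
  proof -
    obtain k where k: "t k \<le> x" "x \<le> t k + \<delta> \<or> k = n"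
      "h (a - \<delta>) + (\<Sum>j\<le>n. c j * max (x - t j) 0) = h (t k - \<delta>) + s k * (x - t k)"
      using act[OF x(1)] by auto
    have "x \<le> t k + \<delta>" using k(2) x(2) \<delta> by (auto simp: t_def)
    \<comment> \<open>One \<delta> pays for the position of \<open>x\<close> inside its cell, the
      other for the shift of the interpolated function.\<close>
    then have "h (x - 2 * \<delta>) \<le> h (t k - \<delta>)" by (intro monoD[OF h(2)]) simp
    also have "\<dots> \<le> h (t k - \<delta>) + s k * (x - t k)" using s0 k(1) by simp
    finally show ?thesis using k(3) by (simp add: t_def)
  qed
qed

text \<open>Comparing E max(Z, t) for all t is the stop-loss order, which yields the increasing
  convex order. Hinge sums are compared term by term; Fatou's lemma on the side of \<open>Z\<close>
  and domination by \<open>h\<close> on the side of \<open>W\<close> give the limit, also when the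
  integrals are infinite.\<close>

lemma increasing_convex_orderI:
  fixes Z :: "'a \<Rightarrow> real" and W :: "'b \<Rightarrow> real"
  assumes M: "prob_space M" and N: "prob_space N"
    and Z: "integrable M Z" "\<And>\<omega>. a \<le> Z \<omega>" and W: "integrable N W" "\<And>\<omega>. a \<le> W \<omega>"
    and stop: "\<And>t. (\<integral>\<omega>. max (Z \<omega>) t \<partial>M) \<le> (\<integral>\<omega>. max (W \<omega>) t \<partial>N)"
    and h: "convex_on UNIV h" "mono h" "0 \<le> h (a - 1)"
  shows "(\<integral>\<^sup>+\<omega>. ennreal (h (Z \<omega>)) \<partial>M) \<le> (\<integral>\<^sup>+\<omega>. ennreal (h (W \<omega>)) \<partial>N)"
proof -
  interpret M: prob_space M by fact
  interpret N: prob_space N by fact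
  have cont: "isCont h x" for x
    using convex_on_continuous[OF open_UNIV h(1)] by (simp add: continuous_on_eq_continuous_at)
  have [measurable]: "h \<in> borel_measurable borel"
    using convex_on_continuous[OF open_UNIV h(1)] by (rule borel_measurable_continuous_onI)
  have [measurable]: "Z \<in> borel_measurable M" "W \<in> borel_measurable N" using Z W by auto
  \<comment> \<open>The mesh shrinks while the (n + 1) squared cells reach up to a + n + 1, so every
    point is eventually inside the grid. Since \<open>\<delta> n \<le> 1\<close>, the assumption on
    h (a - 1) makes all hinge sums nonnegative.\<close>
  define \<delta> where "\<delta> n = 1 / (real n + 1)" for n :: nat
  have \<delta>: "\<delta> n > 0" "\<delta> n \<le> 1" for n by (auto simp: \<delta>_def)
  define t where "t n j = a + real j * \<delta> n" for n j
  define H where "H n c \<longleftrightarrow> (\<forall>j. 0 \<le> c j)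
    \<and> (\<forall>x. a \<le> x \<longrightarrow> h (a - \<delta> n) + (\<Sum>j\<le>(n + 1)\<^sup>2. c j * max (x - t n j) 0) \<le> h x)
    \<and> (\<forall>x. a \<le> x \<longrightarrow> x \<le> a + real ((n + 1)\<^sup>2) * \<delta> n \<longrightarrow>
          h (x - 2 * \<delta> n) \<le> h (a - \<delta> n) + (\<Sum>j\<le>(n + 1)\<^sup>2. c j * max (x - t n j) 0))" for n and c :: "nat \<Rightarrow> real"
  have "\<exists>c :: nat \<Rightarrow> real. H n c" for n :: nat
  proof -
    obtain c :: "nat \<Rightarrow> real" where "\<And>j. 0 \<le> c j"
      "\<And>x. a \<le> x \<Longrightarrow> h (a - \<delta> n) + (\<Sum>j\<le>(n + 1)\<^sup>2. c j * max (x - (a + j * \<delta> n)) 0) \<le> h x"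
      "\<And>x. a \<le> x \<Longrightarrow> x \<le> a + real ((n + 1)\<^sup>2) * \<delta> n \<Longrightarrow>
        h (x - 2 * \<delta> n) \<le> h (a - \<delta> n) + (\<Sum>j\<le>(n + 1)\<^sup>2. c j * max (x - (a + j * \<delta> n)) 0)"
      by (rule convex_mono_hinge_approx[OF h(1,2) \<delta>(1)[of n], of a "(n + 1)\<^sup>2"]) (rule that)
    then have "H n c" unfolding H_def t_def by blast
    then show ?thesis by blast
  qed
  then have "\<exists>c. \<forall>n. H n (c n)" by (intro choice allI)
  then obtain c where "\<And>n. H n (c n)" by blast
  then have c: "\<And>n j. 0 \<le> c n j"
    "\<And>n x. a \<le> x \<Longrightarrow> h (a - \<delta> n) + (\<Sum>j\<le>(n + 1)\<^sup>2. c n j * max (x - t n j) 0) \<le> h x"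
    "\<And>n x. a \<le> x \<Longrightarrow> x \<le> a + real ((n + 1)\<^sup>2) * \<delta> n \<Longrightarrow>
      h (x - 2 * \<delta> n) \<le> h (a - \<delta> n) + (\<Sum>j\<le>(n + 1)\<^sup>2. c n j * max (x - t n j) 0)"
    unfolding H_def by blast+
  define q where "q n x = h (a - \<delta> n) + (\<Sum>j\<le>(n + 1)\<^sup>2. c n j * max (x - t n j) 0)" for n x
  have [measurable]: "q n \<in> borel_measurable borel" for n
    unfolding q_def by measurable
  have "h (a - 1) \<le> h (a - \<delta> n)" for n using \<delta>(2)[of n] by (intro monoD[OF h(2)]) simp
  with h(3) have q0: "0 \<le> q n x" for n x
    unfolding q_def by (intro add_nonneg_nonneg sum_nonneg mult_nonneg_nonneg c) (auto intro: order_trans)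
  \<comment> \<open>Rewriting a hinge as a truncation minus a constant brings it into the form
    handled by \<open>stop\<close>.\<close>
  have q_eq: "q n x = h (a - \<delta> n) + (\<Sum>j\<le>(n + 1)\<^sup>2. c n j * (max x (t n j) - t n j))" for n x
    unfolding q_def by (auto intro!: sum.cong simp: max_def)
  have \<delta>0: "\<delta> \<longlonglongrightarrow> 0"
    unfolding \<delta>_def by (simp add: LIMSEQ_Suc[OF lim_1_over_n, simplified] add.commute)
  have lim: "(\<lambda>n. q n x) \<longlonglongrightarrow> h x" if x: "a \<le> x" for x
  proof (rule tendsto_sandwich)
    have "(\<lambda>n. x - 2 * \<delta> n) \<longlonglongrightarrow> x - 2 * 0" by (intro tendsto_intros \<delta>0)
    then show "(\<lambda>n. h (x - 2 * \<delta> n)) \<longlonglongrightarrow> h x"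
      using isCont_tendsto_compose[OF cont] by simp
    obtain n0 :: nat where n0: "x - a \<le> real n0" using real_arch_simple by blast
    have "h (x - 2 * \<delta> n) \<le> q n x" if "n0 \<le> n" for n
    proof -
      have "real ((n + 1)\<^sup>2) * \<delta> n = real n + 1"
      proof -
        have "real n + 1 \<noteq> 0" by linarith
        then have "(real n + 1) * (real n + 1) * (1 / (real n + 1)) = real n + 1" by simp
        then show ?thesis by (simp only: \<delta>_def power2_eq_square of_nat_mult of_nat_add of_nat_1)
      qed
      moreover have "real n0 \<le> real n" using that by simp
      ultimately have "x \<le> a + real ((n + 1)\<^sup>2) * \<delta> n" using n0 by linarith
      from c(3)[OF x this] show ?thesis by (simp add: q_def)
    qed
    then show "\<forall>\<^sub>F n in sequentially. h (x - 2 * \<delta> n) \<le> q n x"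
      by (auto simp: eventually_sequentially)
    show "\<forall>\<^sub>F n in sequentially. q n x \<le> h x"
      using c(2)[OF x] by (simp add: q_def)
  qed simp
  have Q: "(\<integral>\<^sup>+\<omega>. ennreal (q n (Z \<omega>)) \<partial>M) \<le> (\<integral>\<^sup>+\<omega>. ennreal (q n (W \<omega>)) \<partial>N)" for n
  proof -
    have iZ: "integrable M (\<lambda>\<omega>. max (Z \<omega>) s)" and iW: "integrable N (\<lambda>\<omega>. max (W \<omega>) s)" for s
      using Z W by auto
    have "(\<integral>\<omega>. q n (Z \<omega>) \<partial>M) = h (a - \<delta> n) + (\<Sum>j\<le>(n + 1)\<^sup>2. c n j * ((\<integral>\<omega>. max (Z \<omega>) (t n j) \<partial>M) - t n j))"
      unfolding q_eq using iZ by (simp add: M.prob_space)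
    also have "\<dots> \<le> h (a - \<delta> n) + (\<Sum>j\<le>(n + 1)\<^sup>2. c n j * ((\<integral>\<omega>. max (W \<omega>) (t n j) \<partial>N) - t n j))"
      by (intro add_left_mono sum_mono mult_left_mono c diff_right_mono stop)
    also have "\<dots> = (\<integral>\<omega>. q n (W \<omega>) \<partial>N)"
      unfolding q_eq using iW by (simp add: N.prob_space)
    finally have "ennreal (\<integral>\<omega>. q n (Z \<omega>) \<partial>M) \<le> ennreal (\<integral>\<omega>. q n (W \<omega>) \<partial>N)"
      by (rule ennreal_leI)
    moreover have "integrable M (\<lambda>\<omega>. q n (Z \<omega>))" "integrable N (\<lambda>\<omega>. q n (W \<omega>))"
      unfolding q_eq using iZ iW by auto
    ultimately show ?thesis using q0 by (simp add: nn_integral_eq_integral)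
  qed
  have "(\<integral>\<^sup>+\<omega>. ennreal (h (Z \<omega>)) \<partial>M) = (\<integral>\<^sup>+\<omega>. liminf (\<lambda>n. ennreal (q n (Z \<omega>))) \<partial>M)"
    using lim[OF Z(2)] by (intro nn_integral_cong lim_imp_Liminf[symmetric] tendsto_ennrealI) auto
  also have "\<dots> \<le> liminf (\<lambda>n. \<integral>\<^sup>+\<omega>. ennreal (q n (Z \<omega>)) \<partial>M)"
    by (intro nn_integral_liminf) simp
  also have "\<dots> \<le> liminf (\<lambda>n. \<integral>\<^sup>+\<omega>. ennreal (h (W \<omega>)) \<partial>N)"
  proof (intro Liminf_mono always_eventually allI order_trans[OF Q] nn_integral_mono ennreal_leI)
    show "q n (W \<omega>) \<le> h (W \<omega>)" for n \<omega> using c(2)[OF W(2)] by (simp add: q_def)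
  qed
  also have "\<dots> = (\<integral>\<^sup>+\<omega>. ennreal (h (W \<omega>)) \<partial>N)" by (simp add: Liminf_const)
  finally show ?thesis .
qed

section \<open>Countable index sets\<close>

lemma nn_integral_convex_Max_diff_mono:
  fixes X :: "'i \<Rightarrow> 'a \<Rightarrow> real" and Y :: "'i \<Rightarrow> 'b \<Rightarrow> real"
  assumes M: "prob_space M" and N: "prob_space N" and I: "finite I" and k: "k \<in> I"
    and X: "mean_zero_gaussian_process M I X" and Y: "mean_zero_gaussian_process N I Y"
    and inc: "\<And>i j. i \<in> I \<Longrightarrow> j \<in> I \<Longrightarrow> (\<integral>\<omega>. (X i \<omega> - X j \<omega>)\<^sup>2 \<partial>M) \<le> (\<integral>\<omega>. (Y i \<omega> - Y j \<omega>)\<^sup>2 \<partial>N)"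
    and h: "convex_on UNIV h" "mono h" "0 \<le> h (m k - 1)"
  shows "(\<integral>\<^sup>+\<omega>. ennreal (h (Max ((\<lambda>i. m i + X i \<omega>) ` I) - X k \<omega>)) \<partial>M)
    \<le> (\<integral>\<^sup>+\<omega>. ennreal (h (Max ((\<lambda>i. m i + Y i \<omega>) ` I) - Y k \<omega>)) \<partial>N)"
proof (rule increasing_convex_orderI[OF M N _ _ _ _ _ h])
  interpret M: prob_space M by fact
  interpret N: prob_space N by fact
  note mX = mean_zero_gaussian_process_moments[OF M X] and mY = mean_zero_gaussian_process_moments[OF N Y]
  have I0: "I \<noteq> {}" using k by auto
  show "integrable M (\<lambda>\<omega>. Max ((\<lambda>i. m i + X i \<omega>) ` I) - X k \<omega>)"
    by (intro Bochner_Integration.integrable_diff integrable_Max Bochner_Integration.integrable_add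
        M.integrable_const mX(1) I I0 k)
  show "integrable N (\<lambda>\<omega>. Max ((\<lambda>i. m i + Y i \<omega>) ` I) - Y k \<omega>)"
    by (intro Bochner_Integration.integrable_diff integrable_Max Bochner_Integration.integrable_add
        N.integrable_const mY(1) I I0 k)
  have "m k + x k \<le> Max ((\<lambda>i. m i + x i) ` I)" for x :: "'i \<Rightarrow> real"
    using I k by (intro Max_ge) auto
  then show "m k \<le> Max ((\<lambda>i. m i + X i \<omega>) ` I) - X k \<omega>" "m k \<le> Max ((\<lambda>i. m i + Y i \<omega>') ` I) - Y k \<omega>'" for \<omega> \<omega>'
    by (simp_all add: le_diff_eq)
  show "(\<integral>\<omega>. max (Max ((\<lambda>i. m i + X i \<omega>) ` I) - X k \<omega>) t \<partial>M)
    \<le> (\<integral>\<omega>. max (Max ((\<lambda>i. m i + Y i \<omega>) ` I) - Y k \<omega>) t \<partial>N)" for t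
    by (rule integral_max_Max_diff_mono[OF M N I k X Y inc])
qed

text \<open>A finite supremum is handled by continuity. An infinite one is handled by the limit of
  \<open>g\<close> at infinity, which exists by monotonicity and is therefore the value picked by
  \<open>Lim\<close>. The supremum cannot be minus infinity, as it dominates the real number z
  0.\<close>

lemma extend_by_limits_SUP:
  fixes g :: "real \<Rightarrow> real" and z :: "nat \<Rightarrow> real"
  assumes g: "mono g" "\<And>x. isCont g x" and z: "incseq z"
  shows "extend_by_limits g (SUP n. ereal (z n)) = (SUP n. ereal (g (z n)))"
proof -
  have z': "(\<lambda>n. ereal (z n)) \<longlonglongrightarrow> (SUP n. ereal (z n))"
    using z by (intro LIMSEQ_SUP) (auto simp: incseq_def)
  have gz: "(\<lambda>n. ereal (g (z n))) \<longlonglongrightarrow> (SUP n. ereal (g (z n)))"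
    using z g(1) by (intro LIMSEQ_SUP) (auto simp: incseq_def mono_def)
  show ?thesis
  proof (cases "SUP n. ereal (z n)")
    case (real l)
    with z' have "z \<longlonglongrightarrow> l" by simp
    then have "(\<lambda>n. ereal (g (z n))) \<longlonglongrightarrow> ereal (g l)"
      using isCont_tendsto_compose[OF g(2)] by simp
    from LIMSEQ_unique[OF this gz] show ?thesis
      unfolding real by (simp add: extend_by_limits_def)
  next
    case PInf
    with z' have z_top: "filterlim z at_top sequentially"
      by (simp add: tendsto_PInfty_eq_at_top)
    define L where "L = (SUP t. ereal (g t))"
    have L: "((\<lambda>t. ereal (g t)) \<longlongrightarrow> L) at_top"
    proof (rule order_tendstoI)
      fix b assume "b < L"
      then obtain t0 where "b < ereal (g t0)" unfolding L_def less_SUP_iff by auto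
      then have "b < ereal (g t)" if "t0 \<le> t" for t
        using monoD[OF g(1) that] by (metis ereal_less_eq(3) order_less_le_trans)
      then show "\<forall>\<^sub>F t in at_top. b < ereal (g t)"
        by (auto simp: eventually_at_top_linorder)
    next
      fix b assume "L < b"
      moreover have "ereal (g t) \<le> L" for t unfolding L_def by (rule SUP_upper) simp
      ultimately have "ereal (g t) < b" for t by (metis order_le_less_trans)
      then show "\<forall>\<^sub>F t in at_top. ereal (g t) < b" by simp
    qed
    have "(\<lambda>n. ereal (g (z n))) \<longlonglongrightarrow> L"
      using filterlim_compose[OF L z_top] .
    from LIMSEQ_unique[OF this gz] tendsto_Lim[OF _ L] show ?thesis
      unfolding PInf by (simp add: extend_by_limits_def)
  next
    case MInf
    have "ereal (z 0) \<le> (SUP n. ereal (z n))" by (rule SUP_upper) simp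
    with MInf show ?thesis by simp
  qed
qed

text \<open>The uniform lower bound -C allows a shift into the nonnegative range, where monotone
  convergence applies. It also keeps the integral of the negative part at most \<open>C\<close>, so
  the shift can be undone in the extended reals.\<close>

lemma ext_expectation_SUP:
  fixes u :: "nat \<Rightarrow> 'a \<Rightarrow> real"
  assumes "prob_space M" and u [measurable]: "\<And>n. u n \<in> borel_measurable M"
    and incr: "\<And>\<omega>. incseq (\<lambda>n. u n \<omega>)" and C: "0 \<le> C" "\<And>n \<omega>. 0 \<le> u n \<omega> + C"
  shows "ext_expectation M (\<lambda>\<omega>. SUP n. ereal (u n \<omega>))
    = enn2ereal (SUP n. \<integral>\<^sup>+\<omega>. ennreal (u n \<omega> + C) \<partial>M) - ereal C"
proof -
  interpret prob_space M by fact
  define f where "f \<omega> = (SUP n. ereal (u n \<omega>))" for \<omega>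
  have [measurable]: "f \<in> borel_measurable M" unfolding f_def by measurable
  have lim: "(\<lambda>n. ereal (u n \<omega>)) \<longlonglongrightarrow> f \<omega>" for \<omega>
    unfolding f_def using incr by (intro LIMSEQ_SUP) (auto simp: incseq_def)
  have ge: "ereal (- C) \<le> f \<omega>" for \<omega>
    unfolding f_def using C(2)[of 0 \<omega>] by (intro SUP_upper2[of 0]) auto
  have F: "e2ennreal (f \<omega> + ereal C) = (SUP n. ennreal (u n \<omega> + C))" for \<omega>
  proof (rule LIMSEQ_unique)
    have "(\<lambda>n. ereal (u n \<omega>) + ereal C) \<longlonglongrightarrow> f \<omega> + ereal C"
      by (intro tendsto_add_ereal_general1 tendsto_const lim) auto
    from tendsto_e2ennrealI[OF this] show "(\<lambda>n. ennreal (u n \<omega> + C)) \<longlonglongrightarrow> e2ennreal (f \<omega> + ereal C)"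
      by (simp add: e2ennreal_ereal)
    show "(\<lambda>n. ennreal (u n \<omega> + C)) \<longlonglongrightarrow> (SUP n. ennreal (u n \<omega> + C))"
      using incr[of \<omega>] by (intro LIMSEQ_SUP) (auto simp: incseq_def intro!: ennreal_leI)
  qed
  define A where "A = (\<integral>\<^sup>+\<omega>. e2ennreal (max (f \<omega>) 0) \<partial>M)"
  define D where "D = (\<integral>\<^sup>+\<omega>. e2ennreal (max (- f \<omega>) 0) \<partial>M)"
  define B where "B = (\<integral>\<^sup>+\<omega>. e2ennreal (f \<omega> + ereal C) \<partial>M)"
  have B: "B = (SUP n. \<integral>\<^sup>+\<omega>. ennreal (u n \<omega> + C) \<partial>M)"
    unfolding B_def F using incr
    by (intro nn_integral_monotone_convergence_SUP) (auto simp: incseq_def le_fun_def intro!: ennreal_leI)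
  \<comment> \<open>Positive part plus \<open>C\<close> equals shifted function plus negative part.
    Written without subtraction, the identity can be integrated even where \<open>f\<close> is
    infinite.\<close>
  have pt: "e2ennreal (max (f \<omega>) 0) + ennreal C = e2ennreal (f \<omega> + ereal C) + e2ennreal (max (- f \<omega>) 0)" for \<omega>
    using ge[of \<omega>] C(1)
    by (cases "f \<omega>") (auto simp: e2ennreal_ereal max_def ennreal_plus[symmetric] simp del: ennreal_plus)
  have "A + ennreal C = (\<integral>\<^sup>+\<omega>. e2ennreal (max (f \<omega>) 0) + ennreal C \<partial>M)"
    unfolding A_def by (subst nn_integral_add) (auto simp: emeasure_space_1)
  also have "\<dots> = B + D"
    unfolding pt B_def D_def by (subst nn_integral_add) auto
  finally have AB: "A + ennreal C = B + D" .
  have "D \<le> (\<integral>\<^sup>+\<omega>. ennreal C \<partial>M)"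
    unfolding D_def
  proof (rule nn_integral_mono)
    fix \<omega>
    show "e2ennreal (max (- f \<omega>) 0) \<le> ennreal C"
      using ge[of \<omega>] C(1) by (cases "f \<omega>") (auto simp: e2ennreal_ereal max_def intro!: ennreal_leI)
  qed
  then have D: "D \<le> ennreal C" by (simp add: emeasure_space_1)
  \<comment> \<open>Finiteness of \<open>D\<close> and \<open>C\<close> permits cancellation in
    \<open>AB\<close>; \<open>A\<close> and \<open>B\<close> may be infinite only together.\<close>
  have "enn2ereal A - enn2ereal D = enn2ereal B - ereal C"
    using AB D C(1)
    by (cases A; cases B; cases D)
      (auto simp: ennreal_plus[symmetric] top_unique enn2ereal_ennreal simp del: ennreal_plus)
  then show ?thesis
    unfolding ext_expectation_def A_def D_def B f_def .
qed

theorem mainTheorem3: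
  fixes M :: "'a measure" and N :: "'b measure"
    and I :: "'i set" and k :: 'i
    and X :: "'i \<Rightarrow> 'a \<Rightarrow> real" and Y :: "'i \<Rightarrow> 'b \<Rightarrow> real"
    and m :: "'i \<Rightarrow> real" and g :: "real \<Rightarrow> real"
  assumes "prob_space M" and "prob_space N"
    and "countable I" and "I \<noteq> {}" and "k \<in> I"
    and "mean_zero_gaussian_process M I X"
    and "mean_zero_gaussian_process N I Y"
    and "\<And>i j. i \<in> I \<Longrightarrow> j \<in> I \<Longrightarrow>
           prob_space.expectation M (\<lambda>\<omega>. (X i \<omega> - X j \<omega>)\<^sup>2)
           \<le> prob_space.expectation N (\<lambda>\<omega>. (Y i \<omega> - Y j \<omega>)\<^sup>2)"
    and "mono g" and "convex_on UNIV g"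
    and "extend_by_limits g (-\<infinity>) > -\<infinity> \<or>
         max (ext_expectation M (\<lambda>\<omega>. extend_by_limits (pos_part g) (shifted_sup I m X k \<omega>)))
             (ext_expectation N (\<lambda>\<omega>. extend_by_limits (pos_part g) (shifted_sup I m Y k \<omega>))) < \<infinity>"
  shows "ext_expectation M (\<lambda>\<omega>. extend_by_limits g (shifted_sup I m X k \<omega>))
         \<le> ext_expectation N (\<lambda>\<omega>. extend_by_limits g (shifted_sup I m Y k \<omega>))"
proof -
  note M = assms(1) and N = assms(2) and k = assms(5) and X = assms(6) and Y = assms(7)
  have cont: "isCont g x" for x
    using convex_on_continuous[OF open_UNIV assms(10)] by (simp add: continuous_on_eq_continuous_at)
  have [measurable]: "g \<in> borel_measurable borel"
    using convex_on_continuous[OF open_UNIV assms(10)] by (rule borel_measurable_continuous_onI)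
  \<comment> \<open>Increasing finite sets exhausting \<open>I\<close>. Including \<open>k\<close>
    gives every partial maximum the lower bound \<open>m k\<close>; for finite \<open>I\<close> the
    enumeration merely repeats elements.\<close>
  define J where "J n = insert k (from_nat_into I ` {..n})" for n
  have J: "finite (J n)" "k \<in> J n" "J n \<subseteq> I" "J n \<noteq> {}" for n
    using k from_nat_into[OF assms(4)] by (auto simp: J_def)
  have J_mono: "J n \<subseteq> J n'" if "n \<le> n'" for n n'
    using that by (auto simp: J_def)
  have J_ex: "\<exists>n. i \<in> J n" if "i \<in> I" for i
    using from_nat_into_surj[OF assms(3) that] by (auto simp: J_def)
  define z where "z n x = Max ((\<lambda>i. m i + x i) ` J n) - x k" for n and x :: "'i \<Rightarrow> real"
  have z_inc: "incseq (\<lambda>n. z n x)" for x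
    unfolding incseq_def z_def using J(1,4)
    by (intro allI impI diff_right_mono Max_mono image_mono J_mono) auto
  have z_ge: "m k \<le> z n x" for n x
  proof -
    have "m k + x k \<le> Max ((\<lambda>i. m i + x i) ` J n)" using J by (intro Max_ge) auto
    then show ?thesis by (simp add: z_def)
  qed
  \<comment> \<open>Both inequalities move \<open>x k\<close> across by its finiteness, since the
    supremum itself may be infinite.\<close>
  have sup: "(SUP i\<in>I. ereal (x i + m i)) - ereal (x k) = (SUP n. ereal (z n x))" for x :: "'i \<Rightarrow> real"
  proof (rule antisym)
    have "ereal (x i + m i) \<le> (SUP n. ereal (z n x)) + ereal (x k)" if i: "i \<in> I" for i
    proof -
      obtain n where n: "i \<in> J n" using J_ex[OF i] by blast
      have "m i + x i \<le> Max ((\<lambda>i. m i + x i) ` J n)" using J(1) n by (intro Max_ge) auto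
      then have "ereal (x i + m i) \<le> ereal (z n x) + ereal (x k)" by (simp add: z_def)
      also have "\<dots> \<le> (SUP n. ereal (z n x)) + ereal (x k)"
        by (intro add_right_mono SUP_upper) simp
      finally show ?thesis .
    qed
    then show "(SUP i\<in>I. ereal (x i + m i)) - ereal (x k) \<le> (SUP n. ereal (z n x))"
      by (subst ereal_minus_le) (auto intro: SUP_least)
    have "ereal (z n x) + ereal (x k) \<le> (SUP i\<in>I. ereal (x i + m i))" for n
    proof -
      have "Max ((\<lambda>i. m i + x i) ` J n) \<in> (\<lambda>i. m i + x i) ` J n" using J by (intro Max_in) auto
      then obtain i where i: "i \<in> J n" "Max ((\<lambda>i. m i + x i) ` J n) = m i + x i" by blast
      then have "ereal (z n x) + ereal (x k) = ereal (x i + m i)" by (simp add: z_def)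
      also have "\<dots> \<le> (SUP i\<in>I. ereal (x i + m i))" using i J(3) by (intro SUP_upper) auto
      finally show ?thesis .
    qed
    then show "(SUP n. ereal (z n x)) \<le> (SUP i\<in>I. ereal (x i + m i)) - ereal (x k)"
      by (intro SUP_least) (simp add: ereal_le_minus)
  qed
  have ext: "extend_by_limits g ((SUP i\<in>I. ereal (x i + m i)) - ereal (x k)) = (SUP n. ereal (g (z n x)))" for x
    unfolding sup by (rule extend_by_limits_SUP[OF assms(9) cont z_inc])
  \<comment> \<open>The point m k - 1, not m k, leaves room below the range of \<open>z\<close> for
    the shifted interpolation nodes; \<open>g\<close> plus \<open>C\<close> is nonnegative from
    there on.\<close>
  define C where "C = \<bar>g (m k - 1)\<bar>"
  have gC: "0 \<le> g (z n x) + C" for n x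
  proof -
    have "g (m k - 1) \<le> g (z n x)" using z_ge[of n x] by (intro monoD[OF assms(9)]) simp
    then show ?thesis by (simp add: C_def)
  qed
  have g_inc: "incseq (\<lambda>n. g (z n x))" for x
    using z_inc[of x] monoD[OF assms(9)] by (simp add: incseq_def)
  have zX: "(\<lambda>\<omega>. g (z n (\<lambda>i. X i \<omega>))) \<in> borel_measurable M" for n
  proof -
    have "integrable M (X i)" if "i \<in> I" for i
      using mean_zero_gaussian_process_moments(1)[OF M X that] .
    then have "X i \<in> borel_measurable M" if "i \<in> J n" for i
      using that J(3) by blast
    then have "(\<lambda>\<omega>. z n (\<lambda>i. X i \<omega>)) \<in> borel_measurable M"
      unfolding z_def using J by (intro borel_measurable_diff borel_measurable_Max borel_measurable_add) auto
    then show ?thesis by measurable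
  qed
  have zY: "(\<lambda>\<omega>. g (z n (\<lambda>i. Y i \<omega>))) \<in> borel_measurable N" for n
  proof -
    have "integrable N (Y i)" if "i \<in> I" for i
      using mean_zero_gaussian_process_moments(1)[OF N Y that] .
    then have "Y i \<in> borel_measurable N" if "i \<in> J n" for i
      using that J(3) by blast
    then have "(\<lambda>\<omega>. z n (\<lambda>i. Y i \<omega>)) \<in> borel_measurable N"
      unfolding z_def using J by (intro borel_measurable_diff borel_measurable_Max borel_measurable_add) auto
    then show ?thesis by measurable
  qed
  have fin: "(\<integral>\<^sup>+\<omega>. ennreal (g (z n (\<lambda>i. X i \<omega>)) + C) \<partial>M) \<le> (\<integral>\<^sup>+\<omega>. ennreal (g (z n (\<lambda>i. Y i \<omega>)) + C) \<partial>N)" for n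
    unfolding z_def
  proof (rule nn_integral_convex_Max_diff_mono[OF M N J(1) J(2)])
    show "mean_zero_gaussian_process M (J n) X" "mean_zero_gaussian_process N (J n) Y"
      using X Y J(3) by (auto intro: mean_zero_gaussian_process_subset)
    show "convex_on UNIV (\<lambda>x. g x + C)"
      by (intro convex_on_add assms(10)) (simp add: convex_on_def distrib_right[symmetric])
    show "mono (\<lambda>x. g x + C)" using assms(9) by (simp add: mono_def)
  qed (use assms(8) J(3) in \<open>auto simp: C_def\<close>)
  have "ext_expectation M (\<lambda>\<omega>. extend_by_limits g (shifted_sup I m X k \<omega>))
      = enn2ereal (SUP n. \<integral>\<^sup>+\<omega>. ennreal (g (z n (\<lambda>i. X i \<omega>)) + C) \<partial>M) - ereal C"
    unfolding shifted_sup_def ext[of "\<lambda>i. X i \<omega>" for \<omega>]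
    by (rule ext_expectation_SUP[OF M zX g_inc]) (simp_all add: gC, simp add: C_def)
  also have "\<dots> \<le> enn2ereal (SUP n. \<integral>\<^sup>+\<omega>. ennreal (g (z n (\<lambda>i. Y i \<omega>)) + C) \<partial>N) - ereal C"
    by (intro ereal_minus_mono order_refl) (simp add: less_eq_ennreal.rep_eq[symmetric] SUP_mono' fin)
  also have "\<dots> = ext_expectation N (\<lambda>\<omega>. extend_by_limits g (shifted_sup I m Y k \<omega>))"
    unfolding shifted_sup_def ext[of "\<lambda>i. Y i \<omega>" for \<omega>]
    by (rule ext_expectation_SUP[OF N zY g_inc, symmetric]) (simp_all add: gC, simp add: C_def)
  finally show ?thesis .
qed

end
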